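(* Let $n\ge 3$ be an integer, let $2<k<n$, let $C_{n-2,k}=\frac{K(2,n-k,n)}{4\pi^2}$, and let $\lambda_\ast=\frac{(n-2)^2}{4}$. Let $\beta(\cdot,\cdot)$ denote the Beta function and, for $d\in\mathbb{R}^n$, let $|d|_1=\sum_{i=1}^n|d_i|$ denote the sum norm. (i) (Isotropic multipolar potential) Let $V(x)=\sum_{j=1}^m\frac{\lambda_j}{|x-x^j|^2}$ with $x^j\in\mathbb{R}^n$ and $\lambda_j\in\mathbb{R}$. Then $V\in PM^{n-2}$ and the condition $\|V\|_{PM^{n-2}}<1/C_{n-2,k}$ is satisfied whenever $$\sum_{j=1}^m|\lambda_j|<(k-2)(n-k).$$ The right-hand side is largest for $k=\frac{n+2}{2}$, in which case the restriction becomes $\sum_{j=1}^m|\lambda_j|<\lambda_\ast$. (ii) (Dipole potential) Let $V(x)=\frac{d\cdot x}{|x|^3}$ with $d\in\mathbb{R}^n$. Then $V\in PM^{n-2}$ and the condition $\|V\|_{PM^{n-2}}<1/C_{n-2,k}$ is satisfied whenever $$|d|_1<\frac{\pi}{n-2}\,\frac{(k-2)(n-k)}{\beta\left(\frac12,\frac{n-1}{2}\right)}.$$ The maximum over $k$ of the right-hand side is attained at $k=\frac{n+2}{2}$, in which case the restriction becomes $|d|_1<\frac{\pi}{n-2}\frac{\lambda_\ast}{\beta(\frac12,\frac{n-1}{2})}$. (iii) (Anisotropic multipolar potential) Let $V(x)=\sum_{j=1}^m\frac{(x-x^j)\cdot d^j}{|x-x^j|^3}$ with $x^j,d^j\in\mathbb{R}^n$.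 Then $V\in PM^{n-2}$ and the condition $\|V\|_{PM^{n-2}}<1/C_{n-2,k}$ is satisfied whenever $$\sum_{j=1}^m|d^j|_1<\frac{\pi}{n-2}\,\frac{(k-2)(n-k)}{\beta\left(\frac12,\frac{n-1}{2}\right)}.$$ The maximum over $k$ of the right-hand side is attained at $k=\frac{n+2}{2}$, in which case the restriction becomes $\sum_{j=1}^m|d^j|_1<\frac{\pi}{n-2}\frac{\lambda_\ast}{\beta(\frac12,\frac{n-1}{2})}$.
   Context: The Fourier transform is $\hat f(\xi)=\int_{\mathbb{R}^n}f(x)e^{-2\pi i\xi\cdot x}\,dx$ on $\mathcal{S}(\mathbb{R}^n)$, extended to $\mathcal{S}'(\mathbb{R}^n)$. For $x\in\mathbb{R}^n$ (and $\xi\in\mathbb{R}^n$), $|x|$ is the Euclidean norm. For $k\ge 0$, $PM^k$ is the Banach space of $u\in\mathcal{S}'(\mathbb{R}^n)$ such that $\hat u\in L^1_{loc}(\mathbb{R}^n)$ and $\|u\|_{PM^k}:=\operatorname{ess\,sup}_{\xi\in\mathbb{R}^n}|\xi|^k|\hat u(\xi)|<\infty$. $K(\theta_1,\theta_2,n)=\dfrac{\nu_{\theta_1}\nu_{\theta_2}\nu_{n-\theta_1-\theta_2}}{\nu_{\theta_1+\theta_2}\nu_{n-\theta_1}\nu_{n-\theta_2}}$, where $\nu_\theta=\pi^{-\theta/2}\Gamma(\theta/2)$ and $\Gamma$ is the Gamma function. *)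

theory Defs
  imports "HOL-Analysis.Analysis" "HOL-Probability.Essential_Supremum"
begin

section \<open>Schwartz functions and tempered distributions\<close>

definition partial_deriv :: "'n::finite \<Rightarrow> (real^'n \<Rightarrow> complex) \<Rightarrow> real^'n \<Rightarrow> complex" where
  "partial_deriv i f x = vector_derivative (\<lambda>t. f (x + t *\<^sub>R axis i 1)) (at 0)"

text \<open>A multi-index is represented by a list of directions. The lists of length \<open>l\<close> give
  all partial derivatives of order \<open>l\<close>.\<close>

primrec partial_derivs :: "'n::finite list \<Rightarrow> (real^'n \<Rightarrow> complex) \<Rightarrow> real^'n \<Rightarrow> complex" where
  "partial_derivs [] f = f"
| "partial_derivs (i # is) f = partial_deriv i (partial_derivs is f)"

definition smooth :: "(real^'n::finite \<Rightarrow> complex) \<Rightarrow> bool" where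
  "smooth f \<longleftrightarrow> (\<forall>is. partial_derivs is f differentiable_on UNIV)"

definition schwartz :: "(real^'n::finite \<Rightarrow> complex) set" where
  "schwartz = {f. smooth f \<and>
     (\<forall>N is. bounded (range (\<lambda>x. norm x ^ N * cmod (partial_derivs is f x))))}"

definition schwartz_seminorm ::
    "nat \<Rightarrow> 'n::finite list \<Rightarrow> (real^'n \<Rightarrow> complex) \<Rightarrow> real" where
  "schwartz_seminorm N is f = (SUP x. norm x ^ N * cmod (partial_derivs is f x))"

definition schwartz_topology :: "(real^'n::finite \<Rightarrow> complex) topology" where
  "schwartz_topology = topology_generated_by
     {{g \<in> schwartz. schwartz_seminorm N is (\<lambda>x. g x - f x) < e} | f N is e.
        f \<in> schwartz \<and> e > 0}"

text \<open>Only the values of a functional on \<open>schwartz\<close> matter; outside of it the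
  functional is arbitrary.\<close>

definition tempered_distribution :: "((real^'n::finite \<Rightarrow> complex) \<Rightarrow> complex) \<Rightarrow> bool" where
  "tempered_distribution u \<longleftrightarrow>
     (\<forall>f\<in>schwartz. \<forall>g\<in>schwartz. u (\<lambda>x. f x + g x) = u f + u g) \<and>
     (\<forall>c. \<forall>f\<in>schwartz. u (\<lambda>x. c * f x) = c * u f) \<and>
     continuous_map schwartz_topology euclidean u"

definition fourier :: "(real^'n::finite \<Rightarrow> complex) \<Rightarrow> real^'n \<Rightarrow> complex" where
  "fourier f \<xi> = (LINT x|lebesgue. f x * exp (- 2 * of_real pi * \<i> * of_real (\<xi> \<bullet> x)))"

definition fourier_dist ::
    "((real^'n::finite \<Rightarrow> complex) \<Rightarrow> complex) \<Rightarrow> (real^'n \<Rightarrow> complex) \<Rightarrow> complex" where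
  "fourier_dist u \<phi> = u (fourier \<phi>)"

definition locally_integrable :: "(real^'n::finite \<Rightarrow> complex) \<Rightarrow> bool" where
  "locally_integrable g \<longleftrightarrow> (\<forall>S. compact S \<longrightarrow> g absolutely_integrable_on S)"

definition test_functions :: "(real^'n::finite \<Rightarrow> complex) set" where
  "test_functions = {\<phi>. smooth \<phi> \<and> compact (closure {x. \<phi> x \<noteq> 0})}"

text \<open>\<open>has_density u g\<close> states that the distribution \<open>u\<close> is the locally integrable
  function \<open>g\<close>. It is tested on compactly supported functions, because \<open>g * \<phi>\<close> need
  not be integrable for a Schwartz function \<open>\<phi>\<close>.\<close>

definition has_density ::
    "((real^'n::finite \<Rightarrow> complex) \<Rightarrow> complex) \<Rightarrow> (real^'n \<Rightarrow> complex) \<Rightarrow> bool" where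
  "has_density u g \<longleftrightarrow> locally_integrable g \<and>
     (\<forall>\<phi>\<in>test_functions. u \<phi> = (LINT x|lebesgue. g x * \<phi> x))"

text \<open>A density is unique up to a null set, so the choice does not affect the
  essential supremum below.\<close>

definition density_of ::
    "((real^'n::finite \<Rightarrow> complex) \<Rightarrow> complex) \<Rightarrow> real^'n \<Rightarrow> complex" where
  "density_of u = (SOME g. has_density u g)"


section \<open>The spaces \<open>PM\<^sup>k\<close>\<close>

text \<open>The value of \<open>norm \<xi> powr k\<close> at \<open>\<xi> = 0\<close> is irrelevant, being taken on a null set.\<close>

definition PM_norm :: "real \<Rightarrow> ((real^'n::finite \<Rightarrow> complex) \<Rightarrow> complex) \<Rightarrow> ereal" where
  "PM_norm k u =
     esssup lebesgue (\<lambda>\<xi>. ereal (norm \<xi> powr k * cmod (density_of (fourier_dist u) \<xi>)))"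

definition PM :: "real \<Rightarrow> ((real^'n::finite \<Rightarrow> complex) \<Rightarrow> complex) set" where
  "PM k = {u. tempered_distribution u \<and> (\<exists>g. has_density (fourier_dist u) g) \<and>
              PM_norm k u < \<infinity>}"

definition regular_dist :: "(real^'n::finite \<Rightarrow> complex) \<Rightarrow> (real^'n \<Rightarrow> complex) \<Rightarrow> complex" where
  "regular_dist V \<phi> = (LINT x|lebesgue. V x * \<phi> x)"

text \<open>Membership of a function in \<open>PM\<^sup>k\<close>. The integrability clause ensures that the integral
  defining \<open>regular_dist V\<close> is not the default value 0 of a divergent integral.\<close>

definition in_PM :: "real \<Rightarrow> (real^'n::finite \<Rightarrow> complex) \<Rightarrow> bool" where
  "in_PM k V \<longleftrightarrow>
     (\<forall>\<phi>\<in>schwartz. integrable lebesgue (\<lambda>x. V x * \<phi> x)) \<and> regular_dist V \<in> PM k"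


section \<open>Constants\<close>

definition nu :: "real \<Rightarrow> real" where
  "nu \<theta> = pi powr (- \<theta> / 2) * Gamma (\<theta> / 2)"

definition K_const :: "real \<Rightarrow> real \<Rightarrow> real \<Rightarrow> real" where
  "K_const \<theta>1 \<theta>2 n =
     (nu \<theta>1 * nu \<theta>2 * nu (n - \<theta>1 - \<theta>2)) / (nu (\<theta>1 + \<theta>2) * nu (n - \<theta>1) * nu (n - \<theta>2))"

text \<open>\<open>C_const n k\<close> is \<open>C\<^bsub>n-2,k\<^esub>\<close>, so the first argument is \<open>n\<close> and not \<open>n - 2\<close>.\<close>

definition C_const :: "real \<Rightarrow> real \<Rightarrow> real" where
  "C_const n k = K_const 2 (n - k) n / (4 * pi\<^sup>2)"

definition lambda_star :: "real \<Rightarrow> real" where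
  "lambda_star n = (n - 2)\<^sup>2 / 4"

definition dipole_bound :: "real \<Rightarrow> real \<Rightarrow> real" where
  "dipole_bound n k = pi / (n - 2) * ((k - 2) * (n - k) / Beta (1 / 2) ((n - 1) / 2))"

definition sum_norm :: "real^'n::finite \<Rightarrow> real" where
  "sum_norm d = (\<Sum>i\<in>UNIV. \<bar>d $ i\<bar>)"

end

theory Submission
  imports Defs "HOL-Probability.Characteristic_Functions" "HOL-Probability.Sinc_Integral"
begin

text \<open>Both kinds of potential have an explicit Fourier transform, and the theorem is read off
  from it. With \<open>n\<close> the dimension,

  \<^item> \<open>1 / |x|\<^sup>2\<close> has transform \<open>\<pi> \<nu>\<^sub>n\<^sub>-\<^sub>2 |\<xi>|\<^bsup>2-n\<^esup>\<close>,
  \<^item> \<open>d \<bullet> x / |x|\<^sup>3\<close> has transform \<open>- 2 \<pi> \<i> \<nu>\<^sub>n\<^sub>-\<^sub>1 (d \<bullet> \<xi>) |\<xi>|\<^bsup>1-n\<^esup>\<close>,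

  and moving a pole only multiplies the transform by a phase. Hence \<open>|\<xi>|\<^bsup>n-2\<^esup>\<close> times the transform
  of a multipolar potential is at most \<open>\<pi> \<nu>\<^sub>n\<^sub>-\<^sub>2 \<Sum> |\<lambda>\<^sub>j|\<close>, and for dipoles it is at most
  \<open>2 \<pi> \<nu>\<^sub>n\<^sub>-\<^sub>1 \<Sum> |d\<^sub>j|\<close>, where the Euclidean norm is at most the sum norm. On the other side the
  recurrence of the Gamma function gives \<open>1 / C = \<pi> \<nu>\<^sub>n\<^sub>-\<^sub>2 (k - 2) (n - k)\<close> (\<open>inverse_C_const\<close>),
  and writing the Beta function through Gamma turns the dipole threshold into the same number
  (\<open>dipole_bound_eq\<close>). The best \<open>k\<close> is the vertex of the parabola \<open>(k - 2) (n - k)\<close>.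

  The transforms come from one superposition argument (\<open>homogeneous_fourier\<close>): a power of
  \<open>|x|\<close> is an integral of Gaussians \<open>exp (- \<pi> t |x|\<^sup>2)\<close> against a power of \<open>t\<close>; each Gaussian,
  possibly multiplied by \<open>d \<bullet> x\<close>, has a known transform; and integrating these
  transforms over \<open>t\<close> gives again a power of \<open>|\<xi>|\<close>. All exchanges of integrals are justified by
  pairing with functions of size \<open>(1 + |x|\<^sup>2)\<^bsup>-n\<^esup>\<close>, against which a singularity \<open>|x|\<^bsup>-a\<^esup>\<close> with
  \<open>0 \<le> a < n\<close> is integrable (\<open>integrable_weight\<close>). Test functions, their
  Fourier transforms and Schwartz functions all decay in this way.

  Finally the norm of \<open>PM\<close> refers to an arbitrary density of the transformed distribution, so
  it has to be known that a density is unique almost everywhere (\<open>density_unique\<close>). This needs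
  enough smooth functions of compact support, built from \<open>exp (- 1 / t)\<close>.\<close>

section \<open>Integrals of products over the coordinates\<close>

text \<open>Lebesgue measure on \<open>real^'n\<close> is the image of a product measure indexed by
  the standard basis, so Fubini for products applies after reindexing the basis by
  \<open>'n\<close>.\<close>

lemma integral_prod_vec:
  fixes h :: "'n::finite \<Rightarrow> real \<Rightarrow> 'b::{real_normed_field,banach,second_countable_topology}"
  assumes h: "\<And>i. integrable lborel (h i)"
  shows integrable_prod_vec: "integrable lborel (\<lambda>x::real^'n. \<Prod>i\<in>UNIV. h i (x $ i))"
    and "(LINT x|lborel. (\<Prod>i\<in>UNIV. h i ((x::real^'n) $ i))) = (\<Prod>i\<in>UNIV. LINT t|lborel. h i t)"
proof -
  interpret product_sigma_finite "\<lambda>_::real^'n. lborel :: real measure" ..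
  define e :: "'n \<Rightarrow> real^'n" where "e i = axis i 1" for i
  have inj: "inj e" by (auto simp: e_def inj_def axis_eq_axis)
  have Basis: "Basis = range e" by (auto simp: Basis_vec_def e_def)
  define H where "H b = h (inv e b)" for b
  have He: "H (e i) = h i" for i by (simp add: H_def inv_f_f[OF inj])
  have prod: "(\<Prod>i\<in>UNIV. F (e i)) = (\<Prod>b\<in>Basis. F b)" for F :: "real^'n \<Rightarrow> 'b"
    unfolding Basis by (subst prod.reindex[OF inj]) simp
  have Hint: "integrable lborel (H b)" for b by (simp add: H_def h)
  have Hm [measurable]: "H b \<in> borel_measurable borel" for b
    using Hint[of b] by (auto dest: borel_measurable_integrable)
  have hm [measurable]: "h i \<in> borel_measurable borel" for i
    using h[of i] by (auto dest: borel_measurable_integrable)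
  have eq: "(\<Prod>i\<in>UNIV. h i ((\<Sum>b\<in>Basis. f b *\<^sub>R b) $ i)) = (\<Prod>b\<in>Basis. H b (f b))" for f :: "real^'n \<Rightarrow> real"
  proof -
    have "(\<Sum>b\<in>Basis. f b *\<^sub>R b) $ i = f (e i)" for i
    proof -
      have "(\<Sum>b\<in>Basis. f b *\<^sub>R b) $ i = (\<Sum>b\<in>Basis. f b *\<^sub>R b) \<bullet> e i"
        by (simp add: e_def inner_axis)
      also have "\<dots> = f (e i)"
        by (rule inner_sum_left_Basis) (auto simp: Basis)
      finally show ?thesis .
    qed
    then show ?thesis using prod[of "\<lambda>b. H b (f b)"] by (simp add: He)
  qed
  have meas: "(\<lambda>f. \<Sum>b\<in>Basis. f b *\<^sub>R b) \<in> (\<Pi>\<^sub>M b\<in>(Basis::(real^'n) set). lborel) \<rightarrow>\<^sub>M borel"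
    by measurable
  have m2: "(\<lambda>x::real^'n. \<Prod>i\<in>UNIV. h i (x $ i)) \<in> borel_measurable borel"
    by measurable
  have "integrable (\<Pi>\<^sub>M b\<in>(Basis::(real^'n) set). lborel) (\<lambda>f. \<Prod>b\<in>Basis. H b (f b))"
    by (rule product_integrable_prod) (auto intro: Hint)
  then show "integrable lborel (\<lambda>x::real^'n. \<Prod>i\<in>UNIV. h i (x $ i))"
    by (subst lborel_eq, subst integrable_distr_eq[OF meas m2]) (simp only: eq)
  have "(LINT x|lborel. (\<Prod>i\<in>UNIV. h i ((x::real^'n) $ i)))
      = (LINT f|(\<Pi>\<^sub>M b\<in>(Basis::(real^'n) set). lborel). (\<Prod>b\<in>Basis. H b (f b)))"
    by (subst lborel_eq, subst integral_distr[OF meas m2]) (simp only: eq)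
  also have "\<dots> = (\<Prod>b\<in>Basis. LINT t|lborel. H b t)"
    by (rule product_integral_prod) (auto intro: Hint)
  also have "\<dots> = (\<Prod>i\<in>UNIV. LINT t|lborel. h i t)"
    using prod[of "\<lambda>b. LINT t|lborel. H b t"] by (simp add: He)
  finally show "(LINT x|lborel. (\<Prod>i\<in>UNIV. h i ((x::real^'n) $ i))) = (\<Prod>i\<in>UNIV. LINT t|lborel. h i t)" .
qed

section \<open>An integrable weight with a singularity at the origin\<close>

lemma integrable_even_function:
  fixes w :: "real \<Rightarrow> real"
  assumes w: "set_integrable lborel {0<..} w" and [measurable]: "w \<in> borel_measurable borel"
    and even: "\<And>t. w (- t) = w t" and "w 0 = 0"
  shows "integrable lborel w"
proof -
  define g where "g = (\<lambda>t. indicator {0<..} t *\<^sub>R w t)"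
  have g: "integrable lborel g" using w by (simp add: g_def set_integrable_def)
  have "integrable lborel (\<lambda>t. g (0 + (-1) * t))"
    by (rule lborel_integrable_real_affine[OF g]) simp
  then have "integrable lborel (\<lambda>t. g t + g (- t))" using g by simp
  moreover have "g t + g (- t) = w t" for t
    using even[of t] \<open>w 0 = 0\<close> by (auto simp: g_def indicator_def not_less)
  ultimately show ?thesis by simp
qed

lemma integrable_weight_1:
  fixes b :: real
  assumes b: "0 \<le> b" "b < 1"
  shows "integrable lborel (\<lambda>t::real. \<bar>t\<bar> powr (- b) / (1 + t\<^sup>2))"
proof (rule integrable_even_function)
  have "(\<lambda>t. t powr (- b)) integrable_on {0..1}"
    using b by (intro integrable_on_powr_from_0) auto
  then have "(\<lambda>t. t powr (- b)) absolutely_integrable_on {0..1}"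
    by (intro nonnegative_absolutely_integrable_1) auto
  then have 1: "integrable lborel (\<lambda>t. indicator {0..1} t *\<^sub>R (t powr (- b)))"
    by (simp add: set_integrable_def integrable_completion)
  have "interval_lebesgue_integrable lborel 0 \<infinity> (\<lambda>t::real. 1 / (1 + t\<^sup>2))"
    by (rule integrable_I0i_1_div_plus_square)
  then have 2: "integrable lborel (\<lambda>t::real. indicator {0<..} t *\<^sub>R (1 / (1 + t\<^sup>2)))"
    by (simp add: interval_lebesgue_integrable_def set_integrable_def zero_ereal_def)
  show "set_integrable lborel {0<..} (\<lambda>t. \<bar>t\<bar> powr (- b) / (1 + t\<^sup>2))"
    unfolding set_integrable_def
  proof (rule Bochner_Integration.integrable_bound[OF Bochner_Integration.integrable_add[OF 1 2]])
    show "AE t in lborel. norm (indicator {0<..} t *\<^sub>R (\<bar>t\<bar> powr (- b) / (1 + t\<^sup>2)))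
       \<le> norm (indicator {0..1} t *\<^sub>R (t powr (- b)) + indicator {0<..} t *\<^sub>R (1 / (1 + t\<^sup>2)))"
    proof (rule AE_I2)
      fix t :: real
      have p: "1 + t\<^sup>2 > 0" "1 + t\<^sup>2 \<ge> 1" by (auto simp: add_pos_nonneg)
      show "norm (indicator {0<..} t *\<^sub>R (\<bar>t\<bar> powr (- b) / (1 + t\<^sup>2)))
       \<le> norm (indicator {0..1} t *\<^sub>R (t powr (- b)) + indicator {0<..} t *\<^sub>R (1 / (1 + t\<^sup>2)))"
      proof (cases "0 < t \<and> t \<le> 1")
        case True
        have "t powr (- b) / (1 + t\<^sup>2) \<le> t powr (- b)"
          using mult_left_mono[OF p(2), of "t powr (- b)"] p(1) by (simp add: pos_divide_le_eq)
        moreover have "0 \<le> 1 / (1 + t\<^sup>2)" using p by simp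
        ultimately have "t powr (- b) / (1 + t\<^sup>2) \<le> t powr (- b) + 1 / (1 + t\<^sup>2)" by linarith
        then show ?thesis using True p by (simp add: abs_of_pos)
      next
        case False
        show ?thesis
        proof (cases "t > 1")
          case True
          have "t powr (- b) \<le> t powr 0" using b True by (intro powr_mono) auto
          then have "t powr (- b) \<le> 1" using True by simp
          then show ?thesis using True p by (simp add: divide_right_mono)
        next
          case False
          with \<open>\<not> (0 < t \<and> t \<le> 1)\<close> show ?thesis by (auto simp: indicator_def)
        qed
      qed
    qed
  qed simp
qed auto

text \<open>Off the coordinate hyperplanes all the powers \<open>|x\<^sub>i| powr (- a / n)\<close>
  are genuine; on them they would have the value 0 and could not serve as upper bounds.\<close>

lemma AE_lborel_component_nonzero: "AE x in lborel. \<forall>i. (x::real^'n::finite) $ i \<noteq> 0"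
proof -
  have "AE x in lborel. (x::real^'n) $ i \<noteq> 0" for i
  proof -
    have "negligible {x::real^'n. x $ i = 0}" by (rule negligible_standard_hyperplane_cart)
    then have "AE x in lebesgue. (x::real^'n) $ i \<noteq> 0"
      by (intro AE_I'[of "{x. x $ i = 0}"]) (auto simp: negligible_iff_null_sets)
    then show ?thesis by (simp add: AE_completion_iff)
  qed
  then show ?thesis by (simp add: AE_all_countable)
qed

text \<open>Since \<open>|x| \<ge> |x\<^sub>i|\<close>, the factor
  \<open>|x|\<^bsup>-a\<^esup>\<close> is at most the product of all
  \<open>|x\<^sub>i|\<^bsup>-a/n\<^esup>\<close>, and \<open>(1 +
  |x|\<^sup>2)\<^sup>n\<close> is at least the product of all \<open>1 +
  x\<^sub>i\<^sup>2\<close>. The resulting one-dimensional factors are integrable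
  because \<open>a / n < 1\<close>.\<close>

lemma integrable_weight:
  fixes a :: real
  assumes a: "0 \<le> a" "a < CARD('n::finite)"
  shows "integrable lborel (\<lambda>x::real^'n. norm x powr (- a) / (1 + (norm x)\<^sup>2) ^ CARD('n))"
proof (rule Bochner_Integration.integrable_bound)
  let ?N = "real CARD('n)"
  let ?w = "\<lambda>x::real^'n. (\<Prod>i\<in>UNIV. \<bar>x $ i\<bar> powr (- (a / ?N)) / (1 + (x $ i)\<^sup>2))"
  show "integrable lborel ?w"
    using a by (intro integrable_prod_vec integrable_weight_1) auto
  show "(\<lambda>x::real^'n. norm x powr (- a) / (1 + (norm x)\<^sup>2) ^ CARD('n)) \<in> borel_measurable lborel"
    by measurable
  show "AE x in lborel. norm (norm x powr (- a) / (1 + (norm x)\<^sup>2) ^ CARD('n)) \<le> norm (?w x)"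
    using AE_lborel_component_nonzero
  proof eventually_elim
    case (elim x)
    have x: "norm x > 0" using elim by (auto simp: vec_eq_iff)
    have "norm x powr (- a) = (\<Prod>i\<in>(UNIV::'n set). norm x powr (- (a / ?N)))"
      using x by (simp add: powr_power)
    moreover have "norm x powr (- (a / ?N)) \<le> \<bar>x $ i\<bar> powr (- (a / ?N))" for i
      using elim component_le_norm_cart[of x i] a by (intro powr_mono2') auto
    ultimately have 1: "norm x powr (- a) \<le> (\<Prod>i\<in>UNIV. \<bar>x $ i\<bar> powr (- (a / ?N)))"
      by (simp only:) (rule prod_mono, auto)
    have sq: "(x $ i)\<^sup>2 \<le> (norm x)\<^sup>2" for i
      using component_le_norm_cart[of x i] by (metis abs_ge_zero power2_abs power_mono)
    have "(\<Prod>i\<in>UNIV. 1 + (x $ i)\<^sup>2) \<le> (\<Prod>i\<in>(UNIV::'n set). 1 + (norm x)\<^sup>2)"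
      by (rule prod_mono) (auto simp: sq)
    then have 2: "(\<Prod>i\<in>UNIV. 1 + (x $ i)\<^sup>2) \<le> (1 + (norm x)\<^sup>2) ^ CARD('n)" by simp
    have 3: "(\<Prod>i\<in>UNIV. 1 + (x $ i)\<^sup>2) > 0" by (rule prod_pos) (auto simp: add_pos_nonneg)
    have "norm x powr (- a) / (1 + (norm x)\<^sup>2) ^ CARD('n)
        \<le> (\<Prod>i\<in>UNIV. \<bar>x $ i\<bar> powr (- (a / ?N))) / (\<Prod>i\<in>UNIV. 1 + (x $ i)\<^sup>2)"
      using 1 2 3 by (intro frac_le) (auto intro: prod_nonneg)
    also have "\<dots> = ?w x" by (simp add: prod_dividef)
    finally show ?case by (auto simp: intro: order_trans[OF _ abs_ge_self])
  qed
qed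

section \<open>Gamma integrals\<close>

lemma has_bochner_integral_Gamma:
  fixes s l :: real
  assumes s: "s > 0" and l: "l > 0"
  shows "has_bochner_integral lborel (\<lambda>t. indicator {0<..} t * (t powr (s - 1) * exp (- (l * t)))) (Gamma s / l powr s)"
proof -
  have "has_bochner_integral lborel (\<lambda>t. indicator {0..} t * t powr (s - 1) / exp t) (Gamma s)"
    using s by (intro has_bochner_integral_nn_integral)
      (auto simp: Gamma_conv_nn_integral_real Gamma_real_nonneg intro!: nn_integral_cong)
  then have "has_bochner_integral lborel (\<lambda>t. indicator {0..} (0 + l * t) * (0 + l * t) powr (s - 1) / exp (0 + l * t)) (Gamma s /\<^sub>R \<bar>l\<bar>)"
    using l by (subst lborel_has_bochner_integral_real_affine_iff[of l, symmetric]) auto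
  then have "has_bochner_integral lborel (\<lambda>t. l powr (1 - s) * (indicator {0..} (0 + l * t) * (0 + l * t) powr (s - 1) / exp (0 + l * t)))
     (l powr (1 - s) * (Gamma s /\<^sub>R \<bar>l\<bar>))"
    by (rule has_bochner_integral_mult_right)
  moreover have "l powr (1 - s) * (Gamma s /\<^sub>R \<bar>l\<bar>) = Gamma s / l powr s"
    using l by (simp add: powr_diff field_simps)
  moreover have "l powr (1 - s) * (indicator {0..} (0 + l * t) * (0 + l * t) powr (s - 1) / exp (0 + l * t))
    = indicator {0<..} t * (t powr (s - 1) * exp (- (l * t)))" for t
  proof (cases "t > 0")
    case True
    have "l powr (1 - s) * l powr (s - 1) = 1"
      using l by (simp add: powr_add[symmetric])
    then show ?thesis using l True
      by (simp add: powr_mult exp_minus field_simps)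
  next
    case False
    then show ?thesis using l by (auto simp: indicator_def zero_le_mult_iff)
  qed
  ultimately show ?thesis by simp
qed

text \<open>The Gamma integral after the substitution \<open>t \<mapsto> 1 / t\<close>.\<close>

lemma has_bochner_integral_inverse_Gamma:
  fixes r l :: real
  assumes r: "r > 0" and l: "l > 0"
  shows "has_bochner_integral lborel (\<lambda>t. indicator {0<..} t * (t powr (- r - 1) * exp (- (l / t)))) (Gamma r / l powr r)"
proof -
  let ?f = "\<lambda>t. t powr (r - 1) * exp (- (l * t))"
  let ?g = "\<lambda>t::real. - (1 / t\<^sup>2)"
  have G: "has_bochner_integral lborel (\<lambda>t. indicator {0<..} t *\<^sub>R ?f t) (Gamma r / l powr r)"
    using has_bochner_integral_Gamma[OF r l] by simp
  then have Gi: "set_integrable lborel {0<..} ?f" and Gv: "(LINT t:{0<..}|lborel. ?f t) = Gamma r / l powr r"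
    by (simp_all add: has_bochner_integral_iff set_integrable_def set_lebesgue_integral_def)
  have img: "inverse ` {0<..} = {0::real<..}"
    by (auto simp: image_iff intro!: bexI[of _ "inverse _"])
  have "?f absolutely_integrable_on {0<..}"
    using Gi by (simp add: set_integrable_def integrable_completion)
  moreover have "integral {0<..} ?f = Gamma r / l powr r"
    using set_borel_integral_eq_integral(2)[OF Gi] Gv by simp
  ultimately have "?f absolutely_integrable_on inverse ` {0<..} \<and> integral (inverse ` {0<..}) ?f = Gamma r / l powr r"
    by (simp add: img)
  moreover have "(inverse has_real_derivative ?g t) (at t within {0<..})" if "t \<in> {0<..}" for t
    using that by (auto intro!: derivative_eq_intros simp: power2_eq_square field_simps)
  moreover have "inj_on inverse {0::real<..}" by (auto simp: inj_on_def)
  ultimately have *: "(\<lambda>t. \<bar>?g t\<bar> * ?f (inverse t)) absolutely_integrable_on {0<..} \<and>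
         integral {0<..} (\<lambda>t. \<bar>?g t\<bar> * ?f (inverse t)) = Gamma r / l powr r"
    using has_absolute_integral_change_of_variables_1'[of "{0<..}" inverse ?g ?f "Gamma r / l powr r"] by auto
  have eq: "\<bar>?g t\<bar> * ?f (inverse t) = t powr (- r - 1) * exp (- (l / t))" if "t \<in> {0<..}" for t
  proof -
    have "t powr (- r - 1) = t powr (-2) * t powr (-(r - 1))"
      using that by (simp add: powr_add[symmetric]) (metis minus_diff_commute)
    moreover have "inverse t powr (r - 1) = t powr (-(r - 1))"
      by (subst powr_minus, rule inverse_powr)
    moreover have "t powr (-2) = 1 / t\<^sup>2" using that by (simp add: powr_minus_divide)
    ultimately show ?thesis using that
      by (simp add: divide_inverse)
  qed
  have "(\<lambda>t. t powr (- r - 1) * exp (- (l / t))) absolutely_integrable_on {0<..}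
     \<longleftrightarrow> (\<lambda>t. \<bar>?g t\<bar> * ?f (inverse t)) absolutely_integrable_on {0<..}"
    by (rule set_integrable_cong) (use eq in auto)
  moreover have "integral {0<..} (\<lambda>t. t powr (- r - 1) * exp (- (l / t))) = integral {0<..} (\<lambda>t. \<bar>?g t\<bar> * ?f (inverse t))"
    by (rule integral_cong) (use eq in auto)
  ultimately have A: "(\<lambda>t. t powr (- r - 1) * exp (- (l / t))) absolutely_integrable_on {0<..}"
     "integral {0<..} (\<lambda>t. t powr (- r - 1) * exp (- (l / t))) = Gamma r / l powr r"
    using * by simp_all
  then have B: "set_integrable lborel {0<..} (\<lambda>t. t powr (- r - 1) * exp (- (l / t)))"
    by (simp add: set_integrable_def integrable_completion)
  from set_borel_integral_eq_integral(2)[OF B] A(2) B show ?thesis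
    by (simp add: has_bochner_integral_iff set_integrable_def set_lebesgue_integral_def)
qed

section \<open>Fourier transforms of Gaussians\<close>

lemma fourier_conv_cis:
  fixes f :: "real^'n::finite \<Rightarrow> complex"
  assumes "f \<in> borel_measurable borel"
  shows "fourier f \<xi> = (LINT x|lborel. f x * cis (- 2 * pi * (\<xi> \<bullet> x)))"
proof -
  have "exp (- 2 * complex_of_real pi * \<i> * complex_of_real (\<xi> \<bullet> x)) = cis (- 2 * pi * (\<xi> \<bullet> x))" for x
    by (simp add: cis_conv_exp algebra_simps)
  moreover have "(\<lambda>x. f x * cis (- 2 * pi * (\<xi> \<bullet> x))) \<in> borel_measurable lborel"
    using assms by (simp add: cis_conv_exp)
  ultimately show ?thesis
    unfolding fourier_def by (simp add: integral_completion)
qed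

text \<open>Up to a dilation this is the characteristic function of the standard normal
  distribution.\<close>

lemma gaussian_fourier_1:
  fixes t \<xi> :: real
  assumes t: "t > 0"
  shows "has_bochner_integral lborel (\<lambda>x. of_real (exp (- (pi * t * x\<^sup>2))) * cis (- 2 * pi * (\<xi> * x)))
           (of_real (t powr (- 1 / 2) * exp (- (pi * \<xi>\<^sup>2 / t))))"
proof -
  define c where "c = sqrt (2 * pi * t)"
  define v where "v = - 2 * pi * \<xi> / c"
  have c: "c > 0" using t by (simp add: c_def)
  have c2: "c\<^sup>2 = 2 * pi * t" using t by (simp add: c_def)
  let ?f = "\<lambda>y. std_normal_density y *\<^sub>R iexp (v * y)"
  have "integrable std_normal_distribution (\<lambda>y. iexp (v * y))"
  proof -
    interpret prob_space std_normal_distribution by (rule prob_space_normal_density) simp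
    show ?thesis by (rule integrable_const_bound[where B = 1]) auto
  qed
  then have int: "integrable lborel ?f"
    by (subst (asm) integrable_density) auto
  have "(LINT y|lborel. ?f y) = char std_normal_distribution v"
    unfolding char_def by (subst integral_density) auto
  also have "\<dots> = of_real (exp (- (v\<^sup>2) / 2))"
    by (simp add: char_std_normal_distribution)
  also have "- (v\<^sup>2) / 2 = - (pi * \<xi>\<^sup>2 / t)"
    using t c2 by (simp add: v_def power_divide power_mult_distrib field_simps power2_eq_square[of pi])
  finally have "has_bochner_integral lborel ?f (of_real (exp (- (pi * \<xi>\<^sup>2 / t))))"
    using int by (simp add: has_bochner_integral_iff)
  then have "has_bochner_integral lborel (\<lambda>x. ?f (0 + c * x)) (of_real (exp (- (pi * \<xi>\<^sup>2 / t))) /\<^sub>R \<bar>c\<bar>)"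
    using c by (subst lborel_has_bochner_integral_real_affine_iff[of c, symmetric]) auto
  then have "has_bochner_integral lborel (\<lambda>x. sqrt (2 * pi) *\<^sub>R ?f (0 + c * x)) (sqrt (2 * pi) *\<^sub>R (of_real (exp (- (pi * \<xi>\<^sup>2 / t))) /\<^sub>R \<bar>c\<bar>))"
    by (intro has_bochner_integral_scaleR_right)
  moreover have "sqrt (2 * pi) *\<^sub>R ?f (0 + c * x) = of_real (exp (- (pi * t * x\<^sup>2))) * cis (- 2 * pi * (\<xi> * x))" for x
  proof -
    have "(c * x)\<^sup>2 / 2 = pi * t * x\<^sup>2" by (simp add: power_mult_distrib c2)
    moreover have "v * (c * x) = - 2 * pi * (\<xi> * x)" using c by (simp add: v_def)
    ultimately show ?thesis
      by (simp add: std_normal_density_def scaleR_conv_of_real cis_conv_exp real_sqrt_mult)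
  qed
  moreover have "sqrt (2 * pi) *\<^sub>R (of_real (exp (- (pi * \<xi>\<^sup>2 / t))) /\<^sub>R \<bar>c\<bar>)
     = complex_of_real (t powr (- 1 / 2) * exp (- (pi * \<xi>\<^sup>2 / t)))"
    using t c by (simp add: c_def real_sqrt_mult scaleR_conv_of_real powr_minus powr_half_sqrt divide_simps)
  ultimately show ?thesis by simp
qed

text \<open>The integrand \<open>F\<close> of the Gaussian transform satisfies \<open>F' = - 2 \<pi>
  (t x F + \<i> \<xi> F)\<close>, and the integral of \<open>F'\<close> vanishes because
  \<open>F\<close> tends to 0 at both ends. This expresses the integral of \<open>x
  F\<close> through that of \<open>F\<close>.\<close>

lemma x_gaussian_fourier_1:
  fixes t \<xi> :: real
  assumes t: "t > 0"
  shows "has_bochner_integral lborel (\<lambda>x. of_real x * (of_real (exp (- (pi * t * x\<^sup>2))) * cis (- 2 * pi * (\<xi> * x))))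
           (- \<i> * of_real (\<xi> / t) * of_real (t powr (- 1 / 2) * exp (- (pi * \<xi>\<^sup>2 / t))))"
proof -
  define F where "F x = complex_of_real (exp (- (pi * t * x\<^sup>2))) * cis (- 2 * pi * (\<xi> * x))" for x
  define c where "c = sqrt (2 * pi * t)"
  have c: "c > 0" using t by (simp add: c_def)
  have c2: "c\<^sup>2 = 2 * pi * t" using t by (simp add: c_def)
  have Fexp: "F x = exp (- (of_real (pi * t) * of_real x ^ 2) - 2 * of_real pi * \<i> * of_real \<xi> * of_real x)" for x
    by (simp add: F_def cis_conv_exp exp_of_real[symmetric] exp_add[symmetric] algebra_simps)
  have Fint: "has_bochner_integral lborel F (of_real (t powr (- 1 / 2) * exp (- (pi * \<xi>\<^sup>2 / t))))"
    unfolding F_def by (rule gaussian_fourier_1[OF t])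
  have "integrable lborel (\<lambda>x. std_normal_density x * x ^ 1)"
    by (rule integrable_std_normal_moment)
  then have "integrable lborel (\<lambda>x. std_normal_density (0 + c * x) * (0 + c * x) ^ 1)"
    using c by (intro lborel_integrable_real_affine) auto
  then have "integrable lborel (\<lambda>x. (sqrt (2 * pi) / c) * (std_normal_density (0 + c * x) * (0 + c * x) ^ 1))"
    by (rule integrable_mult_right)
  moreover have "(sqrt (2 * pi) / c) * (std_normal_density (0 + c * x) * (0 + c * x) ^ 1) = x * exp (- (pi * t * x\<^sup>2))" for x
    using c by (simp add: std_normal_density_def power_mult_distrib c2 real_sqrt_mult)
  ultimately have xg: "integrable lborel (\<lambda>x. x * exp (- (pi * t * x\<^sup>2)))" by simp
  have xF: "integrable lborel (\<lambda>x. of_real x * F x)"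
  proof (rule Bochner_Integration.integrable_bound[OF xg])
    show "(\<lambda>x. of_real x * F x) \<in> borel_measurable lborel" unfolding Fexp by simp
    show "AE x in lborel. norm (of_real x * F x) \<le> norm (x * exp (- (pi * t * x\<^sup>2)))"
      by (auto simp: F_def norm_mult)
  qed
  define f where "f x = - 2 * of_real pi * (of_real t * (of_real x * F x) + \<i> * of_real \<xi> * F x)" for x
  have fint: "integrable lborel f"
    unfolding f_def using xF Fint by (auto simp: has_bochner_integral_iff)
  have "(F has_vector_derivative f x) (at x)" for x
    unfolding Fexp[abs_def] f_def
    by (rule derivative_eq_intros has_vector_derivative_real_field refl | simp add: algebra_simps)+
  have lim: "(F \<longlongrightarrow> 0) \<F>" if "filterlim (\<lambda>x::real. x\<^sup>2) at_top \<F>" for \<F>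
  proof (rule tendsto_norm_zero_cancel)
    have "filterlim (\<lambda>x. pi * t * x\<^sup>2) at_top \<F>"
      by (rule filterlim_tendsto_pos_mult_at_top[OF tendsto_const _ that]) (use t in simp)
    then have "((\<lambda>x. exp (- (pi * t * x\<^sup>2))) \<longlongrightarrow> 0) \<F>"
      by (intro filterlim_compose[OF exp_at_bot]) (simp add: filterlim_uminus_at_bot)
    then show "((\<lambda>x. norm (F x)) \<longlongrightarrow> 0) \<F>" by (simp add: F_def norm_mult)
  qed
  have "(LBINT x=-\<infinity>..\<infinity>. f x) = 0 - 0"
  proof (rule interval_integral_FTC_integrable)
    show "((F \<circ> real_of_ereal) \<longlongrightarrow> 0) (at_right (-\<infinity>))" "((F \<circ> real_of_ereal) \<longlongrightarrow> 0) (at_left \<infinity>)"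
      by (simp_all add: ereal_tendsto_simps1 lim filterlim_pow_at_top filterlim_pow_at_bot_even filterlim_ident)
    show "isCont f x" for x unfolding f_def Fexp by (intro continuous_intros)
    show "set_integrable lborel (einterval (- \<infinity>) \<infinity>) f" using fint by (simp add: set_integrable_def)
  qed (auto intro: \<open>(F has_vector_derivative f _) (at _)\<close>)
  then have "(LINT x|lborel. f x) = 0"
    by (simp add: interval_lebesgue_integral_def set_lebesgue_integral_def)
  then have "of_real t * (LINT x|lborel. of_real x * F x) + \<i> * of_real \<xi> * (LINT x|lborel. F x) = 0"
    unfolding f_def using xF Fint by (simp add: has_bochner_integral_iff)
  then have "(LINT x|lborel. of_real x * F x) = - \<i> * of_real (\<xi> / t) * (LINT x|lborel. F x)"
    using t by (simp add: field_simps add_eq_0_iff)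
  then show ?thesis using xF Fint unfolding F_def
    by (simp add: has_bochner_integral_iff)
qed

lemma cis_sum: "finite I \<Longrightarrow> cis (\<Sum>i\<in>I. f i) = (\<Prod>i\<in>I. cis (f i))"
  by (induction I rule: finite_induct) (simp_all add: cis_mult[symmetric])

lemma gaussian_prod:
  fixes x :: "real^'n::finite"
  shows "complex_of_real (exp (- (pi * t * (norm x)\<^sup>2))) * cis (- 2 * pi * (\<xi> \<bullet> x))
    = (\<Prod>i\<in>UNIV. of_real (exp (- (pi * t * (x $ i)\<^sup>2))) * cis (- 2 * pi * (\<xi> $ i * x $ i)))"
proof -
  have "(norm x)\<^sup>2 = (\<Sum>i\<in>UNIV. (x $ i)\<^sup>2)"
    by (simp add: power2_norm_eq_inner inner_vec_def power2_eq_square[of "_ $ _"])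
  then have "exp (- (pi * t * (norm x)\<^sup>2)) = (\<Prod>i\<in>UNIV. exp (- (pi * t * (x $ i)\<^sup>2)))"
    by (simp add: exp_sum[symmetric] sum_distrib_left sum_negf)
  moreover have "cis (- 2 * pi * (\<xi> \<bullet> x)) = (\<Prod>i\<in>UNIV. cis (- 2 * pi * (\<xi> $ i * x $ i)))"
    by (subst cis_sum[symmetric]) (simp_all add: inner_vec_def sum_distrib_left sum_negf)
  ultimately show ?thesis by (simp add: prod.distrib)
qed

lemma gaussian_prod_value:
  fixes \<xi> :: "real^'n::finite"
  assumes "t > 0"
  shows "(\<Prod>i\<in>UNIV. complex_of_real (t powr (- 1 / 2) * exp (- (pi * (\<xi> $ i)\<^sup>2 / t))))
     = of_real (t powr (- real CARD('n) / 2) * exp (- (pi * (norm \<xi>)\<^sup>2 / t)))"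
proof -
  have "(norm \<xi>)\<^sup>2 = (\<Sum>i\<in>UNIV. (\<xi> $ i)\<^sup>2)"
    by (simp add: power2_norm_eq_inner inner_vec_def power2_eq_square[of "_ $ _"])
  then have "exp (- (pi * (norm \<xi>)\<^sup>2 / t)) = (\<Prod>i\<in>UNIV. exp (- (pi * (\<xi> $ i)\<^sup>2 / t)))"
    by (simp add: exp_sum[symmetric] sum_distrib_left sum_negf sum_divide_distrib)
  moreover have "(\<Prod>i\<in>(UNIV::'n set). t powr (- 1 / 2)) = t powr (- real CARD('n) / 2)"
    using assms by (simp add: powr_power)
  ultimately show ?thesis
    unfolding of_real_prod[symmetric] prod.distrib by simp
qed

lemma gaussian_fourier_vec:
  fixes \<xi> :: "real^'n::finite"
  assumes t: "t > 0"
  shows "has_bochner_integral lborel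
     (\<lambda>x. of_real (exp (- (pi * t * (norm x)\<^sup>2))) * cis (- 2 * pi * (\<xi> \<bullet> x)))
     (of_real (t powr (- real CARD('n) / 2) * exp (- (pi * (norm \<xi>)\<^sup>2 / t))))"
  unfolding gaussian_prod gaussian_prod_value[OF t, symmetric]
  using gaussian_fourier_1[OF t] integral_prod_vec[where 'n = 'n and
      h = "\<lambda>i x. of_real (exp (- (pi * t * x\<^sup>2))) * cis (- 2 * pi * (\<xi> $ i * x))"]
  by (simp add: has_bochner_integral_iff)

text \<open>By linearity in \<open>d\<close> only a single coordinate \<open>x\<^sub>i\<close> has
  to be considered. It changes one factor of the product of one-dimensional Gaussians.\<close>

lemma linear_gaussian_fourier_vec:
  fixes \<xi> d :: "real^'n::finite"
  assumes t: "t > 0"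
  shows "has_bochner_integral lborel
     (\<lambda>x. of_real (d \<bullet> x) * (of_real (exp (- (pi * t * (norm x)\<^sup>2))) * cis (- 2 * pi * (\<xi> \<bullet> x))))
     (- \<i> * of_real (d \<bullet> \<xi>) * of_real (t powr (- real CARD('n) / 2 - 1) * exp (- (pi * (norm \<xi>)\<^sup>2 / t))))"
proof -
  define G where "G x = complex_of_real (exp (- (pi * t * (norm x)\<^sup>2))) * cis (- 2 * pi * (\<xi> \<bullet> x))" for x
  define I where "I = complex_of_real (t powr (- real CARD('n) / 2) * exp (- (pi * (norm \<xi>)\<^sup>2 / t)))"
  have one: "has_bochner_integral lborel (\<lambda>x. of_real (x $ i) * G x) (- \<i> * of_real (\<xi> $ i / t) * I)" for i
  proof -
    define h where "h j x = (if j = i then of_real x else 1)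
        * (complex_of_real (exp (- (pi * t * x\<^sup>2))) * cis (- 2 * pi * (\<xi> $ j * x)))" for j x
    define v where "v j = (if j = i then - \<i> * of_real (\<xi> $ i / t) else 1)
        * complex_of_real (t powr (- 1 / 2) * exp (- (pi * (\<xi> $ j)\<^sup>2 / t)))" for j
    have h: "has_bochner_integral lborel (h j) (v j)" for j
      using gaussian_fourier_1[OF t, of "\<xi> $ j"] x_gaussian_fourier_1[OF t, of "\<xi> $ j"]
      by (cases "j = i") (simp_all add: h_def[abs_def] v_def)
    then have "has_bochner_integral lborel (\<lambda>x::real^'n. \<Prod>j\<in>UNIV. h j (x $ j)) (\<Prod>j\<in>UNIV. v j)"
      using integral_prod_vec[of h] by (simp add: has_bochner_integral_iff)
    moreover have "(\<Prod>j\<in>UNIV. h j (x $ j)) = of_real (x $ i) * G x" for x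
      unfolding h_def G_def gaussian_prod by (simp add: prod.distrib)
    moreover have "(\<Prod>j\<in>UNIV. v j) = - \<i> * of_real (\<xi> $ i / t) * I"
      unfolding v_def I_def gaussian_prod_value[OF t, symmetric] by (simp add: prod.distrib)
    ultimately show ?thesis by simp
  qed
  have "has_bochner_integral lborel (\<lambda>x. \<Sum>i\<in>UNIV. of_real (d $ i) * (of_real (x $ i) * G x))
          (\<Sum>i\<in>UNIV. of_real (d $ i) * (- \<i> * of_real (\<xi> $ i / t) * I))"
    by (intro has_bochner_integral_sum has_bochner_integral_mult_right one)
  moreover have "(\<Sum>i\<in>UNIV. of_real (d $ i) * (of_real (x $ i) * G x)) = of_real (d \<bullet> x) * G x" for x
    by (simp add: inner_vec_def sum_distrib_right mult.assoc)
  moreover have "(\<Sum>i\<in>UNIV. of_real (d $ i) * (- \<i> * of_real (\<xi> $ i / t) * I)) = - \<i> * of_real (d \<bullet> \<xi>) * (I / of_real t)"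
    by (simp add: inner_vec_def sum_distrib_right sum_distrib_left mult_ac sum_negf)
  moreover have "I / of_real t = of_real (t powr (- real CARD('n) / 2 - 1) * exp (- (pi * (norm \<xi>)\<^sup>2 / t)))"
    using t by (simp add: I_def powr_diff)
  ultimately show ?thesis unfolding G_def by (simp add: mult_ac)
qed

text \<open>The Fourier kernel is symmetric in its two variables, so this is Fubini.\<close>

lemma fourier_multiplication:
  fixes f g :: "real^'n::finite \<Rightarrow> complex"
  assumes f: "integrable lborel f" and g: "integrable lborel g"
  shows "(LINT x|lborel. f x * fourier g x) = (LINT \<xi>|lborel. fourier f \<xi> * g \<xi>)"
proof -
  have [measurable]: "f \<in> borel_measurable borel" "g \<in> borel_measurable borel"
    using f g by (auto dest: borel_measurable_integrable)
  define F where "F x \<xi> = f x * (g \<xi> * cis (- 2 * pi * (x \<bullet> \<xi>)))" for x \<xi>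
  have cm: "integrable lborel (\<lambda>\<xi>. g \<xi> * cis (- 2 * pi * (x \<bullet> \<xi>)))" for x
  proof (rule Bochner_Integration.integrable_bound[OF g])
    show "(\<lambda>\<xi>. g \<xi> * cis (- 2 * pi * (x \<bullet> \<xi>))) \<in> borel_measurable lborel"
      unfolding cis_conv_exp by measurable
  qed (auto simp: norm_mult)
  have "integrable (lborel \<Otimes>\<^sub>M lborel) (\<lambda>(x, \<xi>). F x \<xi>)"
  proof (rule lborel_pair.Fubini_integrable)
    show "(\<lambda>(x, \<xi>). F x \<xi>) \<in> borel_measurable (lborel \<Otimes>\<^sub>M lborel)"
      unfolding F_def cis_conv_exp by measurable
    show "integrable lborel (\<lambda>x. LINT \<xi>|lborel. norm (case (x, \<xi>) of (x, \<xi>) \<Rightarrow> F x \<xi>))"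
      using f g by (simp add: F_def norm_mult)
    show "AE x in lborel. integrable lborel (\<lambda>\<xi>. case (x, \<xi>) of (x, \<xi>) \<Rightarrow> F x \<xi>)"
      using cm by (simp add: F_def)
  qed
  then have "(LINT \<xi>|lborel. LINT x|lborel. F x \<xi>) = (LINT x|lborel. LINT \<xi>|lborel. F x \<xi>)"
    by (rule lborel_pair.Fubini_integral)
  moreover have "(LINT x|lborel. F x \<xi>) = (LINT x|lborel. f x * cis (- 2 * pi * (\<xi> \<bullet> x))) * g \<xi>" for \<xi>
  proof -
    have "F x \<xi> = (f x * cis (- 2 * pi * (\<xi> \<bullet> x))) * g \<xi>" for x
      by (simp add: F_def inner_commute mult_ac)
    then show ?thesis by (simp only: integral_mult_left_zero)
  qed
  ultimately show ?thesis by (simp add: F_def fourier_conv_cis)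
qed

section \<open>Homogeneous kernels as superpositions of Gaussians\<close>

text \<open>Fubini, where absolute integrability of the double integral comes for free: the kernel
  is nonnegative, so integrating the modulus over \<open>t\<close> reproduces \<open>|f|
  A\<close>.\<close>

lemma integral_superposition:
  fixes f :: "'a::euclidean_space \<Rightarrow> complex" and K :: "real \<Rightarrow> 'a \<Rightarrow> real"
  assumes [measurable]: "f \<in> borel_measurable borel"
    and [measurable]: "(\<lambda>(x, t). K t x) \<in> borel_measurable (lborel \<Otimes>\<^sub>M lborel)"
    and nonneg: "\<And>t x. K t x \<ge> 0"
    and K: "\<And>x. x \<noteq> 0 \<Longrightarrow> has_bochner_integral lborel (\<lambda>t. K t x) (A x)"
    and fA: "integrable lborel (\<lambda>x. f x * of_real (A x))"
  shows "(LINT x|lborel. f x * of_real (A x)) = (LINT t|lborel. LINT x|lborel. f x * of_real (K t x))"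
proof -
  have nz: "AE x in lborel. (x::'a) \<noteq> 0" by (rule AE_lborel_singleton)
  have meas: "(\<lambda>(x, t). f x * complex_of_real (K t x)) \<in> borel_measurable (lborel \<Otimes>\<^sub>M lborel)"
    by measurable
  have A_nonneg: "A x \<ge> 0" if "x \<noteq> 0" for x
    using K[OF that] Bochner_Integration.integral_nonneg[of lborel "\<lambda>t. K t x"] nonneg by (simp add: has_bochner_integral_iff)
  have "integrable (lborel \<Otimes>\<^sub>M lborel) (\<lambda>(x, t). f x * complex_of_real (K t x))"
  proof (rule lborel_pair.Fubini_integrable[OF meas])
    have "integrable lborel (\<lambda>x. norm (f x * of_real (A x)))" using fA by (rule integrable_norm)
    moreover have "AE x in lborel. norm (f x * of_real (A x)) = (LINT t|lborel. norm (f x * complex_of_real (K t x)))"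
      using nz
    proof eventually_elim
      case (elim x)
      have "(LINT t|lborel. norm (f x * complex_of_real (K t x))) = norm (f x) * (LINT t|lborel. K t x)"
        by (simp add: norm_mult nonneg)
      then show ?case using K[OF elim] A_nonneg[OF elim] by (simp add: has_bochner_integral_iff norm_mult nonneg)
    qed
    ultimately show "integrable lborel (\<lambda>x. LINT t|lborel. norm (case (x, t) of (x, t) \<Rightarrow> f x * complex_of_real (K t x)))"
      by (subst integrable_cong_AE[of _ _ "\<lambda>x. norm (f x * of_real (A x))"]) (auto intro!: borel_measurable_integrable)
    show "AE x in lborel. integrable lborel (\<lambda>t. case (x, t) of (x, t) \<Rightarrow> f x * complex_of_real (K t x))"
      using nz by eventually_elim (use K in \<open>auto simp: has_bochner_integral_iff\<close>)
  qed
  then have "(LINT t|lborel. LINT x|lborel. f x * complex_of_real (K t x)) = (LINT x|lborel. LINT t|lborel. f x * complex_of_real (K t x))"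
    by (rule lborel_pair.Fubini_integral)
  also have "\<dots> = (LINT x|lborel. f x * of_real (A x))"
  proof (rule integral_cong_AE)
    show "AE x in lborel. (LINT t|lborel. f x * complex_of_real (K t x)) = f x * of_real (A x)"
      using nz by eventually_elim (use K in \<open>auto simp: has_bochner_integral_iff\<close>)
  qed (use fA in \<open>auto intro: borel_measurable_integrable\<close>)
  finally show ?thesis ..
qed

text \<open>The exponent is the one for which \<open>integrable_weight\<close> applies. Translation
  and modulation preserve this decay without any product rule for iterated derivatives.\<close>

definition decaying :: "(real^'n::finite \<Rightarrow> complex) \<Rightarrow> bool" where
  "decaying f \<longleftrightarrow> f \<in> borel_measurable borel \<and>
     (\<exists>C. \<forall>x. cmod (f x) \<le> C / (1 + (norm x)\<^sup>2) ^ CARD('n))"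

lemma integrable_homogeneous_mult_decaying:
  fixes w f :: "real^'n::finite \<Rightarrow> complex"
  assumes f: "decaying f" and [measurable]: "w \<in> borel_measurable borel"
    and w: "\<And>x. x \<noteq> 0 \<Longrightarrow> cmod (w x) \<le> D * norm x powr (- a)"
    and a: "0 \<le> a" "a < CARD('n)"
  shows "integrable lborel (\<lambda>x. w x * f x)"
proof -
  from f obtain C where [measurable]: "f \<in> borel_measurable borel"
    and C: "\<And>x. cmod (f x) \<le> C / (1 + (norm x)\<^sup>2) ^ CARD('n)"
    by (auto simp: decaying_def)
  show ?thesis
  proof (rule Bochner_Integration.integrable_bound)
    show "integrable lborel (\<lambda>x::real^'n. D * C * (norm x powr (- a) / (1 + (norm x)\<^sup>2) ^ CARD('n)))"
      by (intro integrable_mult_right integrable_weight a)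
    show "AE x in lborel. norm (w x * f x) \<le> norm (D * C * (norm x powr (- a) / (1 + (norm x)\<^sup>2) ^ CARD('n)))"
      using AE_lborel_singleton[of 0]
    proof eventually_elim
      case (elim x)
      have "norm (w x * f x) \<le> (D * norm x powr (- a)) * (C / (1 + (norm x)\<^sup>2) ^ CARD('n))"
        unfolding norm_mult using w[OF elim] by (intro mult_mono C order_trans[OF norm_ge_zero w[OF elim]]) auto
      also have "\<dots> \<le> norm (D * C * (norm x powr (- a) / (1 + (norm x)\<^sup>2) ^ CARD('n)))"
        by (simp add: mult_ac divide_right_mono)
      finally show ?case .
    qed
  qed measurable
qed

text \<open>The factor \<open>nu\<close> is exactly what the Gamma integral with rate \<open>\<pi>
  |x|\<^sup>2\<close> produces.\<close>

lemma Gamma_over_powr_conv_nu: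
  fixes x :: "'a::real_normed_vector"
  assumes "x \<noteq> 0"
  shows "Gamma s / (pi * (norm x)\<^sup>2) powr s = nu (2 * s) * norm x powr (- (2 * s))"
proof -
  have "(norm x)\<^sup>2 powr s = norm x powr (2 * s)"
    using assms by (simp add: powr_numeral[symmetric] powr_powr del: powr_numeral)
  then show ?thesis
    by (simp add: nu_def powr_mult powr_minus field_simps)
qed

text \<open>With \<open>t powr (s - 1)\<close> as weight, Gaussians \<open>exp (- \<pi> t
  |x|\<^sup>2)\<close> add up to a multiple of \<open>|x|\<^bsup>-2s\<^esup>\<close>,
  while their transforms \<open>t\<^bsup>-n/2-c\<^esup> exp (- \<pi> |\<xi>|\<^sup>2 /
  t)\<close> add up to a multiple of \<open>|\<xi>|\<^bsup>-2r\<^esup>\<close>. The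
  polynomial \<open>p\<close> of degree \<open>c\<close> is carried along, since
  Gaussians times \<open>p\<close> transform into Gaussians times \<open>q\<close>. The
  instances used are \<open>p = 1\<close>, \<open>c = 0\<close> and \<open>p =
  (\<bullet>) d\<close>, \<open>c = 1\<close>. The bounds on \<open>2 * s - c\<close>
  and \<open>2 * r - c\<close>, the orders of the two singularities, ensure local
  integrability.\<close>

theorem homogeneous_fourier:
  fixes p q \<phi> :: "real^'n::finite \<Rightarrow> complex" and c s :: real
  defines "r \<equiv> real CARD('n) / 2 + c - s"
  assumes [measurable]: "p \<in> borel_measurable borel" "q \<in> borel_measurable borel"
    and p: "\<And>x. x \<noteq> 0 \<Longrightarrow> cmod (p x) \<le> D * norm x powr c"
    and q: "\<And>x. x \<noteq> 0 \<Longrightarrow> cmod (q x) \<le> E * norm x powr c"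
    and gauss: "\<And>t \<xi>. t > 0 \<Longrightarrow> has_bochner_integral lborel
      (\<lambda>x. p x * (of_real (exp (- (pi * t * (norm x)\<^sup>2))) * cis (- 2 * pi * (\<xi> \<bullet> x))))
      (q \<xi> * of_real (t powr (- real CARD('n) / 2 - c) * exp (- (pi * (norm \<xi>)\<^sup>2 / t))))"
    and s: "0 < s" "0 \<le> 2 * s - c" "2 * s - c < CARD('n)"
    and r: "0 < r" "0 \<le> 2 * r - c" "2 * r - c < CARD('n)"
    and \<phi>: "decaying \<phi>" and decaying_fourier: "decaying (fourier \<phi>)"
  shows "(LINT x|lborel. (p x * of_real (nu (2 * s) * norm x powr (- (2 * s)))) * fourier \<phi> x)
       = (LINT \<xi>|lborel. (q \<xi> * of_real (nu (2 * r) * norm \<xi> powr (- (2 * r)))) * \<phi> \<xi>)"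
proof -
  define \<psi> where "\<psi> = fourier \<phi>"
  have \<psi>: "decaying \<psi>" unfolding \<psi>_def by (rule decaying_fourier)
  have [measurable]: "\<phi> \<in> borel_measurable borel" "\<psi> \<in> borel_measurable borel"
    using \<phi> \<psi> by (auto simp: decaying_def)
  have \<phi>_int: "integrable lborel \<phi>"
    using integrable_homogeneous_mult_decaying[OF \<phi>, of "\<lambda>_. 1" 1 0] by simp
  have bnd: "cmod (w x * of_real (nu u * norm x powr (- u))) \<le> B * \<bar>nu u\<bar> * norm x powr (- (u - c))"
    if w: "\<And>x. x \<noteq> 0 \<Longrightarrow> cmod (w x) \<le> B * norm x powr c" and "x \<noteq> 0" for w :: "real^'n \<Rightarrow> complex" and x u B
  proof -
    have "cmod (w x * of_real (nu u * norm x powr (- u))) = cmod (w x) * (\<bar>nu u\<bar> * norm x powr (- u))"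
      by (simp add: norm_mult)
    also have "\<dots> \<le> (B * norm x powr c) * (\<bar>nu u\<bar> * norm x powr (- u))"
      using w[OF \<open>x \<noteq> 0\<close>] by (intro mult_right_mono) auto
    also have "\<dots> = B * \<bar>nu u\<bar> * norm x powr (- (u - c))"
      by (simp add: powr_add powr_diff powr_minus field_simps)
    finally show ?thesis .
  qed
  define k where "k t = indicator {0<..} t * t powr (s - 1)" for t :: real
  have [measurable]: "k \<in> borel_measurable borel" unfolding k_def by measurable
  \<comment> \<open>The exponents fit together: \<open>(s - 1) + b = - r - 1\<close>.\<close>
  define b where "b = - real CARD('n) / 2 - c"
  have L: "(LINT x|lborel. (p x * \<psi> x) * of_real (nu (2 * s) * norm x powr (- (2 * s))))
      = (LINT t|lborel. LINT x|lborel. (p x * \<psi> x) * of_real (k t * exp (- (pi * t * (norm x)\<^sup>2))))"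
  proof (rule integral_superposition)
    show "(\<lambda>(x::real^'n, t). k t * exp (- (pi * t * (norm x)\<^sup>2))) \<in> borel_measurable (lborel \<Otimes>\<^sub>M lborel)"
      by measurable
    show "has_bochner_integral lborel (\<lambda>t. k t * exp (- (pi * t * (norm x)\<^sup>2))) (nu (2 * s) * norm x powr (- (2 * s)))"
      if "x \<noteq> 0" for x :: "real^'n"
      using has_bochner_integral_Gamma[of s "pi * (norm x)\<^sup>2"] s that
      by (simp add: Gamma_over_powr_conv_nu k_def mult_ac)
    show "integrable lborel (\<lambda>x. p x * \<psi> x * complex_of_real (nu (2 * s) * norm x powr - (2 * s)))"
    proof -
      have "integrable lborel (\<lambda>x. (p x * of_real (nu (2 * s) * norm x powr - (2 * s))) * \<psi> x)"
        by (rule integrable_homogeneous_mult_decaying[OF \<psi> _ bnd[OF p] s(2,3)]) simp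
      then show ?thesis by (simp add: mult_ac)
    qed
  qed (auto simp: k_def)
  have R: "(LINT \<xi>|lborel. (q \<xi> * \<phi> \<xi>) * of_real (nu (2 * r) * norm \<xi> powr (- (2 * r))))
      = (LINT t|lborel. LINT \<xi>|lborel. (q \<xi> * \<phi> \<xi>) * of_real (k t * (t powr b * exp (- (pi * (norm \<xi>)\<^sup>2 / t)))))"
  proof (rule integral_superposition)
    show "(\<lambda>(x::real^'n, t). k t * (t powr b * exp (- (pi * (norm x)\<^sup>2 / t)))) \<in> borel_measurable (lborel \<Otimes>\<^sub>M lborel)"
      by measurable
    show "has_bochner_integral lborel (\<lambda>t. k t * (t powr b * exp (- (pi * (norm x)\<^sup>2 / t)))) (nu (2 * r) * norm x powr (- (2 * r)))"
      if "x \<noteq> 0" for x :: "real^'n"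
    proof -
      have "t powr (- r - 1) = t powr (s - 1) * t powr b" for t
        by (simp add: b_def r_def flip: powr_add) (simp add: algebra_simps)
      then show ?thesis
        using has_bochner_integral_inverse_Gamma[of r "pi * (norm x)\<^sup>2"] r that
        by (simp add: Gamma_over_powr_conv_nu k_def mult_ac)
    qed
    show "integrable lborel (\<lambda>x. q x * \<phi> x * complex_of_real (nu (2 * r) * norm x powr - (2 * r)))"
    proof -
      have "integrable lborel (\<lambda>x. (q x * of_real (nu (2 * r) * norm x powr - (2 * r))) * \<phi> x)"
        by (rule integrable_homogeneous_mult_decaying[OF \<phi> _ bnd[OF q] r(2,3)]) simp
      then show ?thesis by (simp add: mult_ac)
    qed
  qed (auto simp: k_def)
  \<comment> \<open>For each single \<open>t\<close> the Fourier transform is moved from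
      \<open>\<phi>\<close> to the Gaussian.\<close>
  have "(LINT x|lborel. (p x * \<psi> x) * of_real (k t * exp (- (pi * t * (norm x)\<^sup>2))))
     = (LINT \<xi>|lborel. (q \<xi> * \<phi> \<xi>) * of_real (k t * (t powr b * exp (- (pi * (norm \<xi>)\<^sup>2 / t)))))" for t
  proof (cases "t > 0")
    case False
    then show ?thesis by (simp add: k_def)
  next
    case True
    let ?G = "\<lambda>x. p x * of_real (exp (- (pi * t * (norm x)\<^sup>2)))"
    have "integrable lborel ?G"
      using gauss[OF True, of 0] by (simp add: has_bochner_integral_iff)
    then have "(LINT x|lborel. ?G x * \<psi> x) = (LINT \<xi>|lborel. fourier ?G \<xi> * \<phi> \<xi>)"
      unfolding \<psi>_def by (rule fourier_multiplication[OF _ \<phi>_int])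
    also have "\<dots> = (LINT \<xi>|lborel. q \<xi> * of_real (t powr b * exp (- (pi * (norm \<xi>)\<^sup>2 / t))) * \<phi> \<xi>)"
      using gauss[OF True] by (simp add: has_bochner_integral_iff b_def mult.assoc fourier_conv_cis)
    finally have "of_real (k t) * (LINT x|lborel. ?G x * \<psi> x)
       = of_real (k t) * (LINT \<xi>|lborel. q \<xi> * of_real (t powr b * exp (- (pi * (norm \<xi>)\<^sup>2 / t))) * \<phi> \<xi>)" by simp
    then show ?thesis
      unfolding integral_mult_right_zero[symmetric] by (simp add: mult_ac)
  qed
  with L R show ?thesis by (simp add: \<psi>_def mult_ac)
qed

section \<open>Decay of Schwartz functions and of Fourier transforms of test functions\<close>

lemma one_plus_power_le:
  fixes u :: real
  assumes "u \<ge> 0"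
  shows "(1 + u) ^ n \<le> 2 ^ n * (1 + u ^ n)"
proof -
  have "1 + u \<le> 2 * max 1 u" by auto
  then have "(1 + u) ^ n \<le> (2 * max 1 u) ^ n" using assms by (intro power_mono) auto
  also have "(max 1 u) ^ n \<le> 1 + u ^ n" using assms by (auto simp: max_def)
  then have "(2 * max 1 u) ^ n \<le> 2 ^ n * (1 + u ^ n)" by (simp add: power_mult_distrib)
  finally show ?thesis .
qed

lemma decayingI:
  fixes f :: "real^'n::finite \<Rightarrow> complex"
  assumes "f \<in> borel_measurable borel" "\<And>x. cmod (f x) * (1 + (norm x)\<^sup>2) ^ CARD('n) \<le> C"
  shows "decaying f"
proof -
  have "(1 + (norm x)\<^sup>2) ^ CARD('n) > 0" for x :: "real^'n" by (simp add: add_pos_nonneg)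
  with assms show ?thesis by (auto simp: decaying_def pos_le_divide_eq)
qed

lemma decaying_integrable:
  fixes f :: "real^'n::finite \<Rightarrow> complex"
  assumes "decaying f"
  shows "integrable lborel f"
  using integrable_homogeneous_mult_decaying[OF assms, of "\<lambda>_. 1" 1 0] by simp

text \<open>Peetre's inequality: \<open>1 + |x|\<^sup>2 \<le> 2 (1 + |a|\<^sup>2) (1 + |x +
  a|\<^sup>2)\<close>.\<close>

lemma decaying_translate:
  fixes f :: "real^'n::finite \<Rightarrow> complex"
  assumes "decaying f"
  shows "decaying (\<lambda>x. f (x + a))"
proof -
  from assms obtain C where [measurable]: "f \<in> borel_measurable borel"
    and C: "\<And>x. cmod (f x) \<le> C / (1 + (norm x)\<^sup>2) ^ CARD('n)"
    by (auto simp: decaying_def)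
  define B where "B = (2 * (1 + (norm a)\<^sup>2)) ^ CARD('n)"
  have pos: "(1 + (norm x)\<^sup>2) ^ CARD('n) > 0" for x :: "real^'n" by (simp add: add_pos_nonneg)
  have peetre: "(1 + (norm x)\<^sup>2) ^ CARD('n) \<le> B * (1 + (norm (x + a))\<^sup>2) ^ CARD('n)" for x
  proof -
    have "norm x \<le> norm (x + a) + norm a" using norm_triangle_ineq4[of "x + a" a] by simp
    then have "(norm x)\<^sup>2 \<le> (norm (x + a) + norm a)\<^sup>2" by (intro power_mono) auto
    also have "\<dots> \<le> 2 * (norm (x + a))\<^sup>2 + 2 * (norm a)\<^sup>2"
      using zero_le_power2[of "norm (x + a) - norm a"] by (simp add: power2_eq_square algebra_simps)
    finally have "1 + (norm x)\<^sup>2 \<le> 1 + 2 * (norm (x + a))\<^sup>2 + 2 * (norm a)\<^sup>2" by simp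
    also have "\<dots> \<le> (2 * (1 + (norm a)\<^sup>2)) * (1 + (norm (x + a))\<^sup>2)"
      by (simp add: algebra_simps)
    finally show ?thesis
      unfolding B_def power_mult_distrib[symmetric] by (intro power_mono) auto
  qed
  show ?thesis
  proof (rule decayingI)
    show "(\<lambda>x. f (x + a)) \<in> borel_measurable borel" by measurable
    fix x
    have "cmod (f (x + a)) * (1 + (norm x)\<^sup>2) ^ CARD('n) \<le> cmod (f (x + a)) * (B * (1 + (norm (x + a))\<^sup>2) ^ CARD('n))"
      by (intro mult_left_mono peetre) auto
    also have "\<dots> = B * (cmod (f (x + a)) * (1 + (norm (x + a))\<^sup>2) ^ CARD('n))" by simp
    also have "\<dots> \<le> B * C"
      using C[of "x + a"] pos[of "x + a"] by (intro mult_left_mono) (auto simp: pos_le_divide_eq B_def)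
    finally show "cmod (f (x + a)) * (1 + (norm x)\<^sup>2) ^ CARD('n) \<le> B * C" .
  qed
qed

lemma decaying_mult_cis:
  assumes "decaying f"
  shows "decaying (\<lambda>x. f x * cis (b * (a \<bullet> x)))"
proof -
  have "(\<lambda>x. f x * cis (b * (a \<bullet> x))) \<in> borel_measurable borel"
  proof -
    have [measurable]: "f \<in> borel_measurable borel" using assms by (simp add: decaying_def)
    show ?thesis unfolding cis_conv_exp by measurable
  qed
  then show ?thesis using assms by (simp add: decaying_def norm_mult)
qed

lemma differentiable_imp_borel_measurable:
  fixes f :: "real^'n::finite \<Rightarrow> complex"
  assumes "f differentiable_on UNIV"
  shows "f \<in> borel_measurable borel"
  by (rule borel_measurable_continuous_onI[OF differentiable_imp_continuous_on[OF assms]])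

text \<open>The seminorms of orders \<open>0\<close> and \<open>2 * n\<close> without derivatives
  together control \<open>(1 + |x|\<^sup>2)\<^sup>n |f x|\<close>.\<close>

lemma schwartz_imp_decaying:
  fixes f :: "real^'n::finite \<Rightarrow> complex"
  assumes "f \<in> schwartz"
  shows "decaying f"
proof -
  have b: "bounded (range (\<lambda>x. norm x ^ N * cmod (f x)))" for N
  proof -
    have "\<forall>N is. bounded (range (\<lambda>x. norm x ^ N * cmod (partial_derivs is f x)))"
      using assms by (simp add: schwartz_def)
    from this[rule_format, of N "[]"] show ?thesis by simp
  qed
  have "f differentiable_on UNIV"
    using assms unfolding schwartz_def smooth_def by (metis (mono_tags, lifting) mem_Collect_eq partial_derivs.simps(1))
  then have m: "f \<in> borel_measurable borel" by (rule differentiable_imp_borel_measurable)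
  obtain B0 where B0: "\<And>x. cmod (f x) \<le> B0"
    using b[of 0] unfolding bounded_iff by auto
  obtain B1 where B1: "\<And>x. norm x ^ (2 * CARD('n)) * cmod (f x) \<le> B1"
    using b[of "2 * CARD('n)"] unfolding bounded_iff by auto
  show ?thesis
  proof (rule decayingI[OF m])
    fix x
    have "cmod (f x) * (1 + (norm x)\<^sup>2) ^ CARD('n) \<le> cmod (f x) * (2 ^ CARD('n) * (1 + ((norm x)\<^sup>2) ^ CARD('n)))"
      by (intro mult_left_mono one_plus_power_le) auto
    also have "\<dots> = 2 ^ CARD('n) * (cmod (f x) + norm x ^ (2 * CARD('n)) * cmod (f x))"
      unfolding power_mult by (simp add: distrib_left mult_ac)
    also have "\<dots> \<le> 2 ^ CARD('n) * (B0 + B1)"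
      by (intro mult_left_mono add_mono B0 B1) auto
    finally show "cmod (f x) * (1 + (norm x)\<^sup>2) ^ CARD('n) \<le> 2 ^ CARD('n) * (B0 + B1)" .
  qed
qed

lemma has_vector_derivative_partial_deriv:
  fixes f :: "real^'n::finite \<Rightarrow> complex"
  assumes "f differentiable_on UNIV"
  shows "((\<lambda>s. f (x + s *\<^sub>R axis i 1)) has_vector_derivative partial_deriv i f (x + t *\<^sub>R axis i 1)) (at t)"
proof -
  have D: "(f has_derivative frechet_derivative f (at y)) (at y)" for y
    using assms by (auto simp: differentiable_on_def frechet_derivative_works)
  have V: "((\<lambda>s. f (y + s *\<^sub>R axis i 1)) has_vector_derivative
       frechet_derivative f (at (y + t *\<^sub>R axis i 1)) (axis i 1)) (at t)" for y t
  proof -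
    have "((\<lambda>s. y + s *\<^sub>R axis i 1) has_derivative (\<lambda>h. h *\<^sub>R axis i 1)) (at t)"
      by (auto intro!: derivative_eq_intros)
    from has_derivative_compose[OF this D] show ?thesis
      unfolding has_vector_derivative_def
      by (simp add: linear_cmul[OF has_derivative_linear[OF D]])
  qed
  have "partial_deriv i f y = frechet_derivative f (at y) (axis i 1)" for y
    unfolding partial_deriv_def using vector_derivative_at[OF V[of y 0]] by simp
  with V show ?thesis by simp
qed

lemma smooth_imp_differentiable: "smooth f \<Longrightarrow> f differentiable_on UNIV"
  unfolding smooth_def by (metis partial_derivs.simps(1))

lemma partial_derivs_append: "partial_derivs (is @ js) f = partial_derivs is (partial_derivs js f)"
  by (induction "is") auto

text \<open>Off the closed support the function vanishes in a neighbourhood, hence so does its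
  derivative.\<close>

lemma test_functions_partial_deriv:
  fixes f :: "real^'n::finite \<Rightarrow> complex"
  assumes f: "f \<in> test_functions"
  shows "partial_deriv i f \<in> test_functions"
proof -
  have sm: "smooth f" and c: "compact (closure {x. f x \<noteq> 0})"
    using f by (auto simp: test_functions_def)
  have "smooth (partial_deriv i f)"
    unfolding smooth_def
  proof
    fix "is"
    have "partial_derivs (is @ [i]) f differentiable_on UNIV"
      using sm unfolding smooth_def by blast
    then show "partial_derivs is (partial_deriv i f) differentiable_on UNIV"
      by (simp add: partial_derivs_append)
  qed
  moreover have "{x. partial_deriv i f x \<noteq> 0} \<subseteq> closure {x. f x \<noteq> 0}"
  proof (rule ccontr)
    assume "\<not> ?thesis"
    then obtain x where x: "partial_deriv i f x \<noteq> 0" "x \<notin> closure {x. f x \<noteq> 0}" by blast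
    have "open ((\<lambda>s. x + s *\<^sub>R axis i 1) -` (- closure {x. f x \<noteq> 0}))"
      by (intro open_vimage continuous_intros) auto
    moreover have "0 \<in> (\<lambda>s. x + s *\<^sub>R axis i 1) -` (- closure {x. f x \<noteq> 0})" using x by simp
    ultimately have "((\<lambda>s. f (x + s *\<^sub>R axis i 1)) has_vector_derivative 0) (at 0)"
      by (rule has_vector_derivative_transform_within_open[OF has_vector_derivative_const[of 0]])
        (use closure_subset[of "{x. f x \<noteq> 0}"] in auto)
    then have "partial_deriv i f x = 0"
      unfolding partial_deriv_def by (rule vector_derivative_at)
    with x show False by simp
  qed
  then have "closure {x. partial_deriv i f x \<noteq> 0} \<subseteq> closure {x. f x \<noteq> 0}"
    by (rule closure_minimal) simp
  then have "compact (closure {x. partial_deriv i f x \<noteq> 0})"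
    using c by (metis closed_closure compact_Int_closed inf.absorb_iff2)
  ultimately show ?thesis by (simp add: test_functions_def)
qed

lemma test_function_bounds:
  fixes f :: "real^'n::finite \<Rightarrow> complex"
  assumes f: "f \<in> test_functions"
  shows "\<exists>B\<ge>0. \<exists>R\<ge>0. (\<forall>x. cmod (f x) \<le> B) \<and> (\<forall>x. norm x > R \<longrightarrow> f x = 0)"
proof -
  let ?S = "closure {x. f x \<noteq> 0}"
  have c: "compact ?S" and cont: "continuous_on UNIV f"
    using f by (auto simp: test_functions_def dest!: smooth_imp_differentiable intro: differentiable_imp_continuous_on)
  obtain R where R: "\<And>x. x \<in> ?S \<Longrightarrow> norm x \<le> R"
    using compact_imp_bounded[OF c] unfolding bounded_iff by auto
  have "compact (f ` ?S)"
    using c cont by (intro compact_continuous_image continuous_on_subset[OF cont]) auto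
  then obtain B where B: "\<And>x. x \<in> ?S \<Longrightarrow> cmod (f x) \<le> B"
    using compact_imp_bounded[of "f ` ?S"] unfolding bounded_iff by auto
  have "cmod (f x) \<le> max B 0" for x
  proof (cases "f x = 0")
    case False
    then have "x \<in> ?S" using closure_subset[of "{x. f x \<noteq> 0}"] by auto
    from B[OF this] show ?thesis by simp
  qed auto
  moreover have "f x = 0" if "norm x > max R 0" for x
  proof (rule ccontr)
    assume "f x \<noteq> 0"
    then have "x \<in> ?S" using closure_subset[of "{x. f x \<noteq> 0}"] by auto
    from R[OF this] that show False by simp
  qed
  ultimately show ?thesis by (intro exI[of _ "max B 0"] exI[of _ "max R 0"] conjI allI impI) auto
qed

lemma test_function_decaying:
  fixes f :: "real^'n::finite \<Rightarrow> complex"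
  assumes f: "f \<in> test_functions"
  shows "decaying f"
proof -
  obtain B R where B: "\<And>x. cmod (f x) \<le> B" and R: "\<And>x. norm x > R \<Longrightarrow> f x = 0" and "B \<ge> 0" "R \<ge> 0"
    using test_function_bounds[OF f] by blast
  show ?thesis
  proof (rule decayingI)
    show "f \<in> borel_measurable borel"
      using f by (auto simp: test_functions_def intro: differentiable_imp_borel_measurable smooth_imp_differentiable)
    show "cmod (f x) * (1 + (norm x)\<^sup>2) ^ CARD('n) \<le> B * (1 + R\<^sup>2) ^ CARD('n)" for x
    proof (cases "norm x > R")
      case False
      then show ?thesis
        using \<open>B \<ge> 0\<close> by (intro mult_mono B power_mono add_mono) auto
    next
      case True
      then show ?thesis using R \<open>B \<ge> 0\<close> by simp
    qed
  qed
qed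

lemma lborel_integral_translate:
  fixes f :: "'a::euclidean_space \<Rightarrow> 'b::{banach,second_countable_topology}"
  assumes [measurable]: "f \<in> borel_measurable borel"
  shows "(LINT x|lborel. f (x + a)) = (LINT x|lborel. f x)"
    and lborel_integrable_translate: "integrable lborel (\<lambda>x. f (x + a)) \<longleftrightarrow> integrable lborel f"
proof -
  have "(LINT x|lborel. f x) = (LINT x|distr lborel borel ((+) a). f x)"
    by (simp add: lborel_distr_plus)
  also have "\<dots> = (LINT x|lborel. f (x + a))"
    by (subst integral_distr) (auto simp: add.commute)
  finally show "(LINT x|lborel. f (x + a)) = (LINT x|lborel. f x)" ..
  have "integrable lborel f \<longleftrightarrow> integrable (distr lborel borel ((+) a)) f"
    by (simp add: lborel_distr_plus)
  also have "\<dots> \<longleftrightarrow> integrable lborel (\<lambda>x. f (x + a))"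
    by (subst integrable_distr_eq) (auto simp: add.commute)
  finally show "integrable lborel (\<lambda>x. f (x + a)) \<longleftrightarrow> integrable lborel f" ..
qed

lemma diff_quotient_tendsto:
  fixes g :: "real \<Rightarrow> 'a::real_normed_vector"
  assumes g: "(g has_vector_derivative D) (at 0)" and h: "h \<longlonglongrightarrow> 0" "\<And>m. h m > (0::real)"
  shows "(\<lambda>m. (g (h m) - g 0) /\<^sub>R h m) \<longlonglongrightarrow> D"
proof -
  have "((\<lambda>s. norm (g (0 + s) - g 0 - s *\<^sub>R D) / norm s) \<longlongrightarrow> 0) (at 0)"
    using g unfolding has_vector_derivative_def has_derivative_at by blast
  moreover have "filterlim h (at 0) sequentially"
    using h by (auto simp: filterlim_at intro!: always_eventually less_imp_neq[THEN not_sym])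
  ultimately have "(\<lambda>m. norm (g (0 + h m) - g 0 - h m *\<^sub>R D) / norm (h m)) \<longlonglongrightarrow> 0"
    by (rule filterlim_compose)
  moreover have "norm (g (0 + h m) - g 0 - h m *\<^sub>R D) / norm (h m) = norm ((g (h m) - g 0) /\<^sub>R h m - D)" for m
  proof -
    have "(g (h m) - g 0) /\<^sub>R h m - D = (g (0 + h m) - g 0 - h m *\<^sub>R D) /\<^sub>R h m"
      using h(2)[of m] by (simp add: scaleR_diff_right)
    then show ?thesis by (simp add: divide_inverse mult.commute)
  qed
  ultimately show ?thesis by (simp add: Lim_null[of _ D] tendsto_norm_zero_iff)
qed

text \<open>Translation invariance replaces integration by parts: the transform of the difference
  quotient of \<open>f\<close> in direction \<open>i\<close> with step \<open>h\<close>
  is \<open>(cis (2 \<pi> \<xi>\<^sub>i h) - 1) / h\<close> times the transform of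
  \<open>f\<close>. As \<open>h\<close> tends to 0, dominated convergence applies,
  because the quotients are bounded by the supremum of the derivative and live in one
  fixed ball.\<close>

lemma fourier_partial_deriv:
  fixes f :: "real^'n::finite \<Rightarrow> complex"
  assumes f: "f \<in> test_functions"
  shows "fourier (partial_deriv i f) \<xi> = 2 * of_real pi * \<i> * of_real (\<xi> $ i) * fourier f \<xi>"
proof -
  have f': "partial_deriv i f \<in> test_functions" by (rule test_functions_partial_deriv[OF f])
  have [measurable]: "f \<in> borel_measurable borel" "partial_deriv i f \<in> borel_measurable borel"
    using test_function_decaying[OF f] test_function_decaying[OF f'] by (auto simp: decaying_def)
  have diff: "f differentiable_on UNIV" using f by (auto simp: test_functions_def smooth_imp_differentiable)
  let ?e = "axis i 1 :: real^'n"
  let ?E = "\<lambda>x. cis (- 2 * pi * (\<xi> \<bullet> x))"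
  have Emeas [measurable]: "?E \<in> borel_measurable borel" unfolding cis_conv_exp by measurable
  define F where "F = (LINT x|lborel. f x * ?E x)"
  have fE: "integrable lborel (\<lambda>x. f x * ?E x)"
    by (rule decaying_integrable[OF decaying_mult_cis[OF test_function_decaying[OF f]]])
  define h where "h m = inverse (real (Suc m))" for m
  have h: "h m > 0" "h m \<le> 1" for m by (auto simp: h_def field_simps)
  have h0: "h \<longlonglongrightarrow> 0" unfolding h_def[abs_def] by (rule LIMSEQ_inverse_real_of_nat)
  define q where "q m x = (f (x + h m *\<^sub>R ?e) - f x) /\<^sub>R h m" for m x
  have q_lim: "(\<lambda>m. q m x) \<longlonglongrightarrow> partial_deriv i f x" for x
  proof -
    have "((\<lambda>s. f (x + s *\<^sub>R ?e)) has_vector_derivative partial_deriv i f x) (at 0)"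
      using has_vector_derivative_partial_deriv[OF diff, of x i 0] by simp
    from diff_quotient_tendsto[OF this h0 h(1)] show ?thesis by (simp add: q_def)
  qed
  obtain B where B: "\<And>x. cmod (partial_deriv i f x) \<le> B" "B \<ge> 0"
    using test_function_bounds[OF f'] by blast
  obtain R where R: "\<And>x. norm x > R \<Longrightarrow> f x = 0" and "R \<ge> 0"
    using test_function_bounds[OF f] by blast
  have q_bound: "cmod (q m x) \<le> B * indicator (cball 0 (R + 1)) x" for m x
  proof (cases "x \<in> cball 0 (R + 1)")
    case True
    let ?g = "\<lambda>s. f (x + s *\<^sub>R ?e)"
    have d: "(?g has_derivative (\<lambda>u. u *\<^sub>R partial_deriv i f (x + s *\<^sub>R ?e))) (at s)" for s
      by (rule has_vector_derivative_partial_deriv[OF diff, unfolded has_vector_derivative_def])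
    have "continuous_on {0..h m} ?g"
      using has_derivative_continuous[OF d] by (intro continuous_at_imp_continuous_on ballI)
    then have "\<exists>s\<in>{0<..<h m}. norm (?g (h m) - ?g 0) \<le> norm ((h m - 0) *\<^sub>R partial_deriv i f (x + s *\<^sub>R ?e))"
      using h[of m] d by (intro mvt_general) auto
    then obtain s where "norm (?g (h m) - ?g 0) \<le> h m * cmod (partial_deriv i f (x + s *\<^sub>R ?e))"
      using h[of m] by auto
    also have "\<dots> \<le> h m * B" using h[of m] B by (intro mult_left_mono) auto
    finally show ?thesis using True h(1)[of m] by (simp add: q_def divide_simps mult.commute)
  next
    case False
    then have "norm x > R + 1" by (simp add: not_le)
    moreover have "norm x \<le> norm (x + h m *\<^sub>R ?e) + h m"
      using norm_triangle_ineq4[of "x + h m *\<^sub>R ?e" "h m *\<^sub>R ?e"] h[of m] by simp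
    ultimately have "f x = 0" "f (x + h m *\<^sub>R ?e) = 0" using h(2)[of m] by (auto intro!: R)
    then show ?thesis using B by (simp add: q_def)
  qed
  have lim1: "(\<lambda>m. LINT x|lborel. q m x * ?E x) \<longlonglongrightarrow> (LINT x|lborel. partial_deriv i f x * ?E x)"
  proof (rule integral_dominated_convergence)
    show "integrable lborel (\<lambda>x::real^'n. B * indicator (cball 0 (R + 1)) x)"
      by (intro integrable_mult_right integrable_real_indicator) (use emeasure_bounded_finite[OF bounded_cball] in auto)
    show "AE x in lborel. (\<lambda>m. q m x * ?E x) \<longlonglongrightarrow> partial_deriv i f x * ?E x"
      by (auto intro!: tendsto_mult q_lim)
    show "AE x in lborel. norm (q m x * ?E x) \<le> B * indicator (cball 0 (R + 1)) x" for m
      using q_bound by (simp add: norm_mult)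
    show "(\<lambda>x. q m x * ?E x) \<in> borel_measurable lborel" for m unfolding q_def by measurable
  qed measurable
  have "(LINT x|lborel. q m x * ?E x) = ((cis (2 * pi * \<xi> $ i * h m) - 1) /\<^sub>R h m) * F" for m
  proof -
    let ?z = "cis (2 * pi * \<xi> $ i * h m)"
    have eq: "f (x + h m *\<^sub>R ?e) * ?E x = ?z * (f (x + h m *\<^sub>R ?e) * ?E (x + h m *\<^sub>R ?e))" for x
      by (simp add: inner_add_right inner_axis cis_mult algebra_simps)
    let ?g = "\<lambda>x. f x * ?E x"
    have gm: "?g \<in> borel_measurable borel" by measurable
    have "integrable lborel (\<lambda>x. ?g (x + h m *\<^sub>R ?e))" "(LINT x|lborel. ?g (x + h m *\<^sub>R ?e)) = F"
      using lborel_integrable_translate[OF gm] lborel_integral_translate[OF gm] fE by (simp_all add: F_def)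
    moreover have "q m x * ?E x = (?z * ?g (x + h m *\<^sub>R ?e) - ?g x) /\<^sub>R h m" for x
      unfolding eq[symmetric] q_def by (simp add: algebra_simps)
    ultimately have "(LINT x|lborel. q m x * ?E x) = (?z * F - F) /\<^sub>R h m"
      using fE by (simp add: F_def)
    then show ?thesis by (simp add: algebra_simps)
  qed
  then have "(\<lambda>m. LINT x|lborel. q m x * ?E x) = (\<lambda>m. ((cis (2 * pi * \<xi> $ i * h m) - 1) /\<^sub>R h m) * F)"
    by auto
  moreover have "(\<lambda>m. ((cis (2 * pi * \<xi> $ i * h m) - 1) /\<^sub>R h m) * F) \<longlonglongrightarrow> (2 * of_real pi * \<i> * of_real (\<xi> $ i)) * F"
  proof -
    have "((\<lambda>s. cis (2 * pi * \<xi> $ i * s)) has_vector_derivative 2 * of_real pi * \<i> * of_real (\<xi> $ i)) (at 0)"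
      unfolding has_vector_derivative_def
      by (auto intro!: derivative_eq_intros simp: scaleR_conv_of_real)
    from diff_quotient_tendsto[OF this h0 h(1)] show ?thesis by (intro tendsto_mult) auto
  qed
  ultimately show ?thesis using LIMSEQ_unique[OF lim1] unfolding F_def by (simp add: fourier_conv_cis)
qed

lemma fourier_partial_derivs:
  fixes f :: "real^'n::finite \<Rightarrow> complex"
  assumes f: "f \<in> test_functions"
  shows "partial_derivs (replicate N i) f \<in> test_functions \<and>
    fourier (partial_derivs (replicate N i) f) \<xi> = (2 * of_real pi * \<i> * of_real (\<xi> $ i)) ^ N * fourier f \<xi>"
proof (induction N)
  case (Suc N)
  then show ?case
    using fourier_partial_deriv[of "partial_derivs (replicate N i) f" i \<xi>]
      test_functions_partial_deriv[of "partial_derivs (replicate N i) f" i] by (simp add: mult.assoc)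
qed (simp add: f)

text \<open>The transform of the \<open>N\<close>-th derivative in direction \<open>i\<close> is
  bounded, which bounds \<open>|\<xi>\<^sub>i|\<^sup>N |fourier f \<xi>|\<close>.
  Derivatives in a single direction suffice, since \<open>|\<xi>|\<close> is comparable
  to its largest component.\<close>

lemma test_function_fourier_decaying:
  fixes f :: "real^'n::finite \<Rightarrow> complex"
  assumes f: "f \<in> test_functions"
  shows "decaying (fourier f)"
proof -
  define F where "F = fourier f"
  have [measurable]: "f \<in> borel_measurable borel"
    using test_function_decaying[OF f] by (auto simp: decaying_def)
  have "F = (\<lambda>\<xi>. LINT x|lborel. f x * cis (- 2 * pi * (\<xi> \<bullet> x)))"
    unfolding F_def by (rule ext) (rule fourier_conv_cis, measurable)
  then have m: "F \<in> borel_measurable borel"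
    unfolding cis_conv_exp by simp
  have bound: "\<exists>B. \<forall>\<xi>. \<bar>\<xi> $ i\<bar> ^ N * cmod (F \<xi>) \<le> B" for i N
  proof -
    let ?g = "partial_derivs (replicate N i) f"
    have "?g \<in> test_functions" using fourier_partial_derivs[OF f] by blast
    then have gm: "?g \<in> borel_measurable borel"
      using test_function_decaying by (auto simp: decaying_def)
    have "\<bar>\<xi> $ i\<bar> ^ N * cmod (F \<xi>) \<le> (LINT x|lborel. cmod (?g x))" for \<xi>
    proof -
      have "\<bar>\<xi> $ i\<bar> ^ N \<le> (2 * pi * \<bar>\<xi> $ i\<bar>) ^ N"
        using pi_gt3 by (intro power_mono) (auto simp: mult_le_cancel_right1)
      then have "\<bar>\<xi> $ i\<bar> ^ N * cmod (F \<xi>) \<le> (2 * pi * \<bar>\<xi> $ i\<bar>) ^ N * cmod (F \<xi>)"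
        by (rule mult_right_mono) simp
      also have "\<dots> = cmod (LINT x|lborel. ?g x * cis (- 2 * pi * (\<xi> \<bullet> x)))"
        using fourier_partial_derivs[OF f, of N i \<xi>] fourier_conv_cis[OF gm, of \<xi>]
        by (simp add: F_def norm_mult norm_power)
      also have "\<dots> \<le> (LINT x|lborel. cmod (?g x * cis (- 2 * pi * (\<xi> \<bullet> x))))"
        by (rule integral_norm_bound)
      finally show ?thesis by (simp add: norm_mult)
    qed
    then show ?thesis by blast
  qed
  obtain B0 where B0: "\<And>\<xi>. cmod (F \<xi>) \<le> B0" using bound[where N = 0] by auto
  obtain B where B: "\<And>i \<xi>. \<bar>\<xi> $ i\<bar> ^ (2 * CARD('n)) * cmod (F \<xi>) \<le> B i"
    using bound[where N = "2 * CARD('n)"] by metis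
  let ?M = "\<Sum>i\<in>UNIV. \<bar>B i\<bar>"
  show ?thesis
    unfolding F_def[symmetric]
  proof (rule decayingI[OF m])
    fix \<xi> :: "real^'n"
    obtain i where i: "\<And>j. \<bar>\<xi> $ j\<bar> \<le> \<bar>\<xi> $ i\<bar>"
    proof -
      have "Max (range (\<lambda>j. \<bar>\<xi> $ j\<bar>)) \<in> range (\<lambda>j. \<bar>\<xi> $ j\<bar>)" by (rule Max_in) auto
      then obtain i where "\<bar>\<xi> $ i\<bar> = Max (range (\<lambda>j. \<bar>\<xi> $ j\<bar>))"
        unfolding image_iff by metis
      then have "\<bar>\<xi> $ j\<bar> \<le> \<bar>\<xi> $ i\<bar>" for j by simp
      then show ?thesis by (rule that)
    qed
    let ?n = "CARD('n)"
    have "(norm \<xi>)\<^sup>2 = (\<Sum>j\<in>UNIV. (\<xi> $ j)\<^sup>2)"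
      by (simp add: power2_norm_eq_inner inner_vec_def power2_eq_square[of "_ $ _"])
    also have "\<dots> \<le> (\<Sum>j\<in>(UNIV::'n set). (\<xi> $ i)\<^sup>2)"
      by (intro sum_mono) (use i in \<open>simp add: abs_le_square_iff\<close>)
    finally have n2: "(norm \<xi>)\<^sup>2 \<le> real ?n * (\<xi> $ i)\<^sup>2" by simp
    have "(1 + (norm \<xi>)\<^sup>2) ^ ?n \<le> (1 + real ?n * (\<xi> $ i)\<^sup>2) ^ ?n"
      using n2 by (intro power_mono) auto
    also have "\<dots> \<le> 2 ^ ?n * (1 + (real ?n * (\<xi> $ i)\<^sup>2) ^ ?n)"
      by (rule one_plus_power_le) simp
    also have "(real ?n * (\<xi> $ i)\<^sup>2) ^ ?n = real ?n ^ ?n * \<bar>\<xi> $ i\<bar> ^ (2 * ?n)"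
      by (simp add: power_mult_distrib power_mult)
    finally have "cmod (F \<xi>) * (1 + (norm \<xi>)\<^sup>2) ^ ?n \<le> cmod (F \<xi>) * (2 ^ ?n * (1 + real ?n ^ ?n * \<bar>\<xi> $ i\<bar> ^ (2 * ?n)))"
      by (rule mult_left_mono) simp
    also have "\<dots> = 2 ^ ?n * (cmod (F \<xi>) + real ?n ^ ?n * (\<bar>\<xi> $ i\<bar> ^ (2 * ?n) * cmod (F \<xi>)))"
      by (simp add: algebra_simps)
    also have "\<dots> \<le> 2 ^ ?n * (B0 + real ?n ^ ?n * ?M)"
    proof -
      have "B i \<le> \<bar>B i\<bar>" by simp
      also have "\<dots> \<le> ?M" by (rule member_le_sum) auto
      finally show ?thesis
        using B[of \<xi> i] by (intro mult_left_mono add_mono B0) auto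
    qed
    finally show "cmod (F \<xi>) * (1 + (norm \<xi>)\<^sup>2) ^ ?n \<le> 2 ^ ?n * (B0 + real ?n ^ ?n * ?M)" .
  qed
qed

section \<open>Smooth bumps\<close>

text \<open>Polynomials in \<open>1 / t\<close> times \<open>exp (- 1 / t)\<close>, extended by 0,
  form a family that contains the standard flat function and is closed under
  derivatives.\<close>

definition flat :: "real poly \<Rightarrow> real \<Rightarrow> real" where
  "flat P t = (if t > 0 then poly P (1 / t) * exp (- (1 / t)) else 0)"

lemma poly_times_exp_tendsto_0: "((\<lambda>u. poly P u * exp (- u)) \<longlongrightarrow> (0::real)) at_top"
proof -
  have "((\<lambda>u. \<Sum>i\<le>degree P. coeff P i * (u ^ i / exp u)) \<longlongrightarrow> (\<Sum>i\<le>degree P. coeff P i * 0)) at_top"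
    by (intro tendsto_intros tendsto_power_div_exp_0)
  then show ?thesis
    by (simp add: poly_altdef sum_distrib_right exp_minus divide_inverse mult.assoc)
qed

lemma flat_tendsto_0: "(flat P \<longlongrightarrow> 0) (at 0)"
proof -
  have "((\<lambda>t. poly P (inverse t) * exp (- (inverse t))) \<longlongrightarrow> 0) (at_right 0)"
    by (rule filterlim_compose[OF poly_times_exp_tendsto_0 filterlim_inverse_at_top_right])
  then have "(flat P \<longlongrightarrow> 0) (at_right 0)"
    by (rule Lim_transform_eventually)
      (auto simp: flat_def eventually_at_filter divide_inverse intro!: always_eventually)
  moreover have "(flat P \<longlongrightarrow> 0) (at_left 0)"
    by (rule Lim_transform_eventually[OF tendsto_const])
      (auto simp: flat_def eventually_at_filter intro!: always_eventually)
  ultimately show ?thesis by (simp add: filterlim_at_split)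
qed

text \<open>For \<open>t > 0\<close> this is the chain rule. At the origin the difference quotient
  is itself a flat function, namely the one of \<open>X P\<close>, and tends to 0.\<close>

lemma flat_has_real_derivative:
  "(flat P has_real_derivative flat ([:0, 0, 1:] * (P - pderiv P)) t) (at t)"
proof -
  consider "t > 0" | "t < 0" | "t = 0" by linarith
  then show ?thesis
  proof cases
    case 1
    have "((\<lambda>t. poly P (1 / t) * exp (- (1 / t))) has_real_derivative flat ([:0, 0, 1:] * (P - pderiv P)) t) (at t)"
      using 1 by (auto intro!: derivative_eq_intros simp: flat_def divide_simps power2_eq_square)
         (simp add: algebra_simps)
    then show ?thesis
      by (rule has_field_derivative_transform_within_open[of _ _ _ "{0<..}"]) (use 1 in \<open>auto simp: flat_def\<close>)
  next
    case 2
    have "((\<lambda>_. 0) has_real_derivative flat ([:0, 0, 1:] * (P - pderiv P)) t) (at t)"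
      using 2 by (simp add: flat_def)
    then show ?thesis
      by (rule has_field_derivative_transform_within_open[of _ _ _ "{..<0}"]) (use 2 in \<open>auto simp: flat_def\<close>)
  next
    case 3
    have "((\<lambda>h. (flat P (0 + h) - flat P 0) / h) \<longlongrightarrow> 0) (at 0)"
    proof (rule Lim_transform_eventually[OF flat_tendsto_0[of "[:0, 1:] * P"]])
      show "\<forall>\<^sub>F h in at 0. flat ([:0, 1:] * P) h = (flat P (0 + h) - flat P 0) / h"
        by (auto simp: flat_def eventually_at_filter intro!: always_eventually)
    qed
    then show ?thesis using 3 by (simp add: DERIV_def flat_def)
  qed
qed

text \<open>Products of flat functions in the variables \<open>m (x\<^sub>i - a\<^sub>i)\<close> and
  \<open>m (b\<^sub>i - x\<^sub>i)\<close>, supported in a box, with their linear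
  combinations. Allowing all polynomials makes the span closed under partial
  derivatives, so that smoothness needs no Leibniz rule. The parameter \<open>m\<close>
  steepens the flanks.\<close>

inductive_set bumps :: "real \<Rightarrow> real^'n::finite \<Rightarrow> real^'n \<Rightarrow> (real^'n \<Rightarrow> complex) set"
  for m a b where
  prod: "(\<lambda>x. of_real (\<Prod>i\<in>UNIV. flat (P i) (m * (x $ i - a $ i)) * flat (Q i) (m * (b $ i - x $ i)))) \<in> bumps m a b"
| add: "f \<in> bumps m a b \<Longrightarrow> g \<in> bumps m a b \<Longrightarrow> (\<lambda>x. f x + g x) \<in> bumps m a b"
| scale: "f \<in> bumps m a b \<Longrightarrow> (\<lambda>x. of_real c * f x) \<in> bumps m a b"

lemma bumps_support:
  assumes "f \<in> bumps m a b" "m > 0" "f x \<noteq> 0"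
  shows "x \<in> box a b"
  using assms
proof (induction arbitrary: x)
  case (prod P Q)
  then have nz: "flat (P i) (m * (x $ i - a $ i)) \<noteq> 0" "flat (Q i) (m * (b $ i - x $ i)) \<noteq> 0" for i
    by (simp_all add: prod_zero_iff)
  have "a $ i < x $ i \<and> x $ i < b $ i" for i
    using nz[of i] \<open>m > 0\<close> by (auto simp: flat_def zero_less_mult_iff split: if_splits)
  then show ?case by (simp add: mem_box_cart)
next
  case (add f g)
  then show ?case by (cases "f x = 0") auto
qed auto

lemma differentiable_of_real_comp:
  assumes "h differentiable (at x within S)"
  shows "(\<lambda>x. complex_of_real (h x)) differentiable (at x within S)"
proof -
  from assms obtain D where "(h has_derivative D) (at x within S)" by (auto simp: differentiable_def)
  from has_derivative_of_real[OF this] show ?thesis by (rule differentiableI)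
qed

lemma bumps_differentiable:
  assumes "f \<in> bumps m a (b :: real^'n::finite)"
  shows "f differentiable_on UNIV"
  using assms
proof induction
  case (prod P Q)
  have d: "(flat P differentiable (at t))" for P t
    using flat_has_real_derivative[of P t] by (auto simp: real_differentiable_def)
  have "(\<lambda>x::real^'n. flat (P i) (m * (x $ i - a $ i))) differentiable (at x)" for x i
    by (rule differentiable_compose[OF d]) (auto intro!: derivative_intros simp: bounded_linear_imp_differentiable bounded_linear_vec_nth)
  moreover have "(\<lambda>x::real^'n. flat (Q i) (m * (b $ i - x $ i))) differentiable (at x)" for x i
    by (rule differentiable_compose[OF d]) (auto intro!: derivative_intros simp: bounded_linear_imp_differentiable bounded_linear_vec_nth)
  ultimately have "(\<lambda>x::real^'n. flat (P i) (m * (x $ i - a $ i)) * flat (Q i) (m * (b $ i - x $ i))) differentiable (at x)" for x i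
    by (intro derivative_intros)
  then have "(\<lambda>x::real^'n. \<Prod>i\<in>UNIV. flat (P i) (m * (x $ i - a $ i)) * flat (Q i) (m * (b $ i - x $ i))) differentiable (at x)" for x
    by (intro differentiableI[OF has_derivative_prod]) (simp add: frechet_derivative_works)
  then show ?case
    unfolding differentiable_on_def by (intro ballI differentiable_of_real_comp)
qed (auto intro!: derivative_intros)

lemma partial_deriv_eqI:
  assumes "((\<lambda>s. f (x + s *\<^sub>R axis i 1)) has_vector_derivative D) (at 0)"
  shows "partial_deriv i f x = D"
  using assms unfolding partial_deriv_def by (rule vector_derivative_at)

lemma has_vector_derivative_partial_deriv_0:
  fixes f :: "real^'n::finite \<Rightarrow> complex"
  assumes "f differentiable_on UNIV"
  shows "((\<lambda>s. f (x + s *\<^sub>R axis i 1)) has_vector_derivative partial_deriv i f x) (at 0)"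
  using has_vector_derivative_partial_deriv[OF assms, of x i 0] by simp

text \<open>Along direction \<open>i\<close> only the two factors with index \<open>i\<close> vary,
  so the product rule gives two products of the same shape.\<close>

lemma partial_deriv_bumps:
  assumes "f \<in> bumps m a (b :: real^'n::finite)"
  shows "partial_deriv i f \<in> bumps m a b"
  using assms
proof induction
  case (prod P Q)
  define D where "D P = [:0, 0, 1:] * (P - pderiv P)" for P :: "real poly"
  have flat': "((\<lambda>s. flat P (g s)) has_real_derivative flat (D P) (g s) * g') (at s)"
    if "(g has_real_derivative g') (at s)" for P g g' s
    unfolding D_def by (rule DERIV_chain2[OF flat_has_real_derivative that])
  define pr where "pr P Q x = (\<Prod>i\<in>UNIV. flat (P i) (m * (x $ i - a $ i)) * flat (Q i) (m * (b $ i - x $ i)))"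
    for P Q and x :: "real^'n"
  have split: "pr P Q x = (flat (P i) (m * (x $ i - a $ i)) * flat (Q i) (m * (b $ i - x $ i))) *
      (\<Prod>j\<in>UNIV-{i}. flat (P j) (m * (x $ j - a $ j)) * flat (Q j) (m * (b $ j - x $ j)))" for P Q x
    unfolding pr_def by (rule prod.remove) auto
  have "((\<lambda>s. complex_of_real (pr P Q (x + s *\<^sub>R axis i 1))) has_vector_derivative
     of_real m * of_real (pr (P(i := D (P i))) Q x) + of_real (- m) * of_real (pr P (Q(i := D (Q i))) x)) (at 0)" for x
  proof -
    have "(\<Prod>j\<in>UNIV-{i}. flat (P j) (m * ((x + s *\<^sub>R axis i 1) $ j - a $ j)) * flat (Q j) (m * (b $ j - (x + s *\<^sub>R axis i 1) $ j)))
       = (\<Prod>j\<in>UNIV-{i}. flat (P j) (m * (x $ j - a $ j)) * flat (Q j) (m * (b $ j - x $ j)))" for s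
      by (intro prod.cong) (auto simp: axis_def)
    then have "pr P Q (x + s *\<^sub>R axis i 1) = (flat (P i) (m * (x $ i + s - a $ i)) * flat (Q i) (m * (b $ i - (x $ i + s)))) *
      (\<Prod>j\<in>UNIV-{i}. flat (P j) (m * (x $ j - a $ j)) * flat (Q j) (m * (b $ j - x $ j)))" for s
      unfolding split by simp
    moreover have "((\<lambda>s. (flat (P i) (m * (x $ i + s - a $ i)) * flat (Q i) (m * (b $ i - (x $ i + s)))) *
      (\<Prod>j\<in>UNIV-{i}. flat (P j) (m * (x $ j - a $ j)) * flat (Q j) (m * (b $ j - x $ j)))) has_real_derivative
       m * pr (P(i := D (P i))) Q x + (- m) * pr P (Q(i := D (Q i))) x) (at 0)"
      unfolding split by (auto intro!: derivative_eq_intros flat' simp: algebra_simps)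
    ultimately have "((\<lambda>s. pr P Q (x + s *\<^sub>R axis i 1)) has_real_derivative
       m * pr (P(i := D (P i))) Q x + (- m) * pr P (Q(i := D (Q i))) x) (at 0)" by simp
    from has_vector_derivative_of_real[OF this]
    show ?thesis by simp
  qed
  then have "partial_deriv i (\<lambda>x. complex_of_real (pr P Q x)) = (\<lambda>x.
      of_real m * of_real (pr (P(i := D (P i))) Q x) + of_real (- m) * of_real (pr P (Q(i := D (Q i))) x))"
    by (intro ext partial_deriv_eqI)
  also have "\<dots> \<in> bumps m a b"
    unfolding pr_def by (intro bumps.intros)
  finally show ?case unfolding pr_def .
next
  case (add f g)
  have "partial_deriv i (\<lambda>x. f x + g x) = (\<lambda>x. partial_deriv i f x + partial_deriv i g x)"
    using add.hyps[THEN bumps_differentiable]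
    by (intro ext partial_deriv_eqI has_vector_derivative_add has_vector_derivative_partial_deriv_0)
  then show ?case using add.IH by (simp add: bumps.add)
next
  case (scale f c)
  have "partial_deriv i (\<lambda>x. of_real c * f x) = (\<lambda>x. of_real c * partial_deriv i f x)"
    using scale.hyps[THEN bumps_differentiable]
    by (intro ext partial_deriv_eqI has_vector_derivative_mult_right has_vector_derivative_partial_deriv_0)
  then show ?case using scale.IH by (simp add: bumps.scale)
qed

lemma bumps_test_functions:
  assumes f: "f \<in> bumps m a (b :: real^'n::finite)" and m: "m > 0"
  shows "f \<in> test_functions"
proof -
  have derivs: "partial_derivs js f \<in> bumps m a b" for js
    by (induction js) (auto simp only: partial_derivs.simps intro: f partial_deriv_bumps)
  have "smooth f"
    unfolding smooth_def
  proof
    fix js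
    show "partial_derivs js f differentiable_on UNIV" by (rule bumps_differentiable[OF derivs])
  qed
  moreover have "closure {x. f x \<noteq> 0} \<subseteq> cbox a b"
  proof (rule closure_minimal)
    show "{x. f x \<noteq> 0} \<subseteq> cbox a b"
      using bumps_support[OF f m] box_subset_cbox[of a b] by blast
  qed (rule closed_cbox)
  from bounded_subset[OF bounded_cbox this] have "compact (closure {x. f x \<noteq> 0})"
    by (simp add: compact_eq_bounded_closed)
  ultimately show ?thesis by (simp add: test_functions_def)
qed

text \<open>For \<open>t > 0\<close> the values \<open>exp (- 1 / (m t))\<close> increase to 1 as
  \<open>m\<close> grows.\<close>

lemma exists_test_functions_tendsto_indicator_box:
  fixes a b :: "real^'n::finite"
  obtains \<beta> :: "nat \<Rightarrow> real^'n \<Rightarrow> complex" where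
    "\<And>m. \<beta> m \<in> test_functions" "\<And>m x. cmod (\<beta> m x) \<le> indicator (cbox a b) x"
    "\<And>x. (\<lambda>m. \<beta> m x) \<longlonglongrightarrow> indicator (box a b) x"
proof -
  define \<beta> where "\<beta> m x = complex_of_real (\<Prod>i\<in>UNIV. flat 1 (real (Suc m) * (x $ i - a $ i)) * flat 1 (real (Suc m) * (b $ i - x $ i)))"
    for m and x :: "real^'n"
  have bumps: "\<beta> m \<in> bumps (real (Suc m)) a b" for m
    unfolding \<beta>_def by (rule bumps.prod)
  have flat1: "0 \<le> flat 1 t" "flat 1 t \<le> 1" for t by (auto simp: flat_def)
  have "cmod (\<beta> m x) \<le> 1" for m x
  proof -
    have "(\<Prod>i\<in>UNIV. flat 1 (real (Suc m) * (x $ i - a $ i)) * flat 1 (real (Suc m) * (b $ i - x $ i))) \<le> 1"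
      by (intro prod_le_1 conjI mult_le_one mult_nonneg_nonneg flat1)
    moreover have "0 \<le> (\<Prod>i\<in>UNIV. flat 1 (real (Suc m) * (x $ i - a $ i)) * flat 1 (real (Suc m) * (b $ i - x $ i)))"
      by (intro prod_nonneg mult_nonneg_nonneg flat1 ballI)
    ultimately show ?thesis unfolding \<beta>_def by (simp del: of_nat_Suc of_real_prod of_real_mult)
  qed
  then have bound: "cmod (\<beta> m x) \<le> indicator (cbox a b) x" for m x
    using bumps_support[OF bumps, of m x] box_subset_cbox[of a b] by (cases "\<beta> m x = 0") auto
  have lim: "(\<lambda>m. \<beta> m x) \<longlonglongrightarrow> indicator (box a b) x" for x
  proof (cases "x \<in> box a b")
    case False
    then have "\<beta> m x = 0" for m using bumps_support[OF bumps, of m x] by auto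
    then show ?thesis using False by simp
  next
    case True
    have f1: "(\<lambda>m. flat 1 (real (Suc m) * t)) \<longlonglongrightarrow> 1" if "t > 0" for t
    proof -
      have "(\<lambda>m. exp (- (inverse (real (Suc m)) * inverse t))) \<longlonglongrightarrow> exp (- (0 * inverse t))"
        by (intro tendsto_intros LIMSEQ_inverse_real_of_nat)
      then show ?thesis using that by (simp add: flat_def divide_inverse mult.commute)
    qed
    have "(\<lambda>m. \<beta> m x) \<longlonglongrightarrow> complex_of_real (\<Prod>i\<in>(UNIV::'n set). 1 * 1)"
      unfolding \<beta>_def using True by (intro tendsto_of_real tendsto_prod tendsto_mult f1) (auto simp: mem_box_cart)
    then show ?thesis using True by simp
  qed
  show ?thesis using that[OF bumps_test_functions[OF bumps] bound lim] by simp
qed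

section \<open>Uniqueness of densities\<close>

lemma locally_integrable_measurable:
  assumes "locally_integrable g"
  shows "g \<in> borel_measurable lebesgue"
proof (rule borel_measurable_LIMSEQ_metric)
  let ?f = "\<lambda>m x. indicator (cball 0 (real m)) x *\<^sub>R g x"
  show "?f m \<in> borel_measurable lebesgue" for m
    using assms unfolding locally_integrable_def set_integrable_def
    by (intro borel_measurable_integrable) auto
  show "(\<lambda>m. ?f m x) \<longlonglongrightarrow> g x" for x
  proof (rule Lim_transform_eventually[OF tendsto_const])
    have "\<forall>\<^sub>F m in sequentially. norm x \<le> real m"
      by (metis eventually_sequentiallyI nat_ceiling_le_eq)
    then show "\<forall>\<^sub>F m in sequentially. g x = ?f m x"
      by eventually_elim simp
  qed
qed

text \<open>The difference \<open>w\<close> of two densities is annihilated by all test functions,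
  hence, approximating indicators boundedly, has integral 0 over every box. By
  Lebesgue's differentiation theorem its averages over shrinking cubes converge to
  \<open>w\<close> almost everywhere.\<close>

theorem density_unique:
  fixes u :: "(real^'n::finite \<Rightarrow> complex) \<Rightarrow> complex"
  assumes g: "has_density u g" and h: "has_density u h"
  shows "AE x in lebesgue. g x = h x"
proof -
  have loc: "locally_integrable g" "locally_integrable h"
    using g h by (auto simp: has_density_def)
  have absint: "g absolutely_integrable_on cbox a b" "h absolutely_integrable_on cbox a b" for a b
    using loc by (auto simp: locally_integrable_def)
  define w where "w x = g x - h x" for x
  have w_abs: "w absolutely_integrable_on cbox a b" for a b
    unfolding w_def by (intro set_integral_diff absint)
  have w_meas [measurable]: "w \<in> borel_measurable lebesgue"
    unfolding w_def using loc[THEN locally_integrable_measurable] by measurable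
  have zero: "integral (cbox a b) w = 0" for a b
  proof -
    obtain \<beta> :: "nat \<Rightarrow> real^'n \<Rightarrow> complex" where \<beta>: "\<And>m. \<beta> m \<in> test_functions"
      "\<And>m x. cmod (\<beta> m x) \<le> indicator (cbox a b) x" "\<And>x. (\<lambda>m. \<beta> m x) \<longlonglongrightarrow> indicator (box a b) x"
      using exists_test_functions_tendsto_indicator_box[of a b] by metis
    have \<beta>m [measurable]: "\<beta> m \<in> borel_measurable lebesgue" for m
      using test_function_decaying[OF \<beta>(1)] by (auto simp: decaying_def intro: measurable_completion)
    have w_box: "w absolutely_integrable_on box a b"
      by (rule set_integrable_subset[OF w_abs[of a b]]) (auto simp: box_subset_cbox)
    have int: "integrable lebesgue (\<lambda>x. v x * \<beta> m x)" if "v absolutely_integrable_on cbox a b" "v \<in> borel_measurable lebesgue"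
      for v m
    proof (rule Bochner_Integration.integrable_bound[OF that(1)[unfolded set_integrable_def]])
      show "(\<lambda>x. v x * \<beta> m x) \<in> borel_measurable lebesgue" using that(2) by measurable
      show "AE x in lebesgue. norm (v x * \<beta> m x) \<le> norm (indicator (cbox a b) x *\<^sub>R v x)"
        using mult_left_mono[OF \<beta>(2)] by (auto simp: norm_mult mult.commute)
    qed
    have "(LINT x|lebesgue. w x * \<beta> m x) = 0" for m
    proof -
      have "(LINT x|lebesgue. w x * \<beta> m x) = (LINT x|lebesgue. g x * \<beta> m x - h x * \<beta> m x)"
        by (simp add: w_def algebra_simps)
      also have "\<dots> = (LINT x|lebesgue. g x * \<beta> m x) - (LINT x|lebesgue. h x * \<beta> m x)"
        by (intro Bochner_Integration.integral_diff int absint locally_integrable_measurable loc)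
      also have "\<dots> = u (\<beta> m) - u (\<beta> m)"
        using g h \<beta>(1) by (simp add: has_density_def)
      finally show ?thesis by simp
    qed
    moreover have "(\<lambda>m. LINT x|lebesgue. w x * \<beta> m x) \<longlonglongrightarrow> (LINT x|lebesgue. indicator (box a b) x *\<^sub>R w x)"
    proof (rule integral_dominated_convergence)
      show "integrable lebesgue (\<lambda>x. norm (indicator (cbox a b) x *\<^sub>R w x))"
        using w_abs unfolding set_integrable_def by (rule integrable_norm)
      show "AE x in lebesgue. (\<lambda>m. w x * \<beta> m x) \<longlonglongrightarrow> indicator (box a b) x *\<^sub>R w x"
      proof (rule AE_I2)
        fix x
        have "(\<lambda>m. w x * \<beta> m x) \<longlonglongrightarrow> w x * indicator (box a b) x"
          by (intro tendsto_mult tendsto_const \<beta>(3))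
        then show "(\<lambda>m. w x * \<beta> m x) \<longlonglongrightarrow> indicator (box a b) x *\<^sub>R w x"
          by (cases "x \<in> box a b") auto
      qed
      show "AE x in lebesgue. norm (w x * \<beta> m x) \<le> norm (indicator (cbox a b) x *\<^sub>R w x)" for m
        using mult_left_mono[OF \<beta>(2)] by (auto simp: norm_mult mult.commute)
      show "(\<lambda>x. w x * \<beta> m x) \<in> borel_measurable lebesgue" for m by measurable
      show "(\<lambda>x. indicator (box a b) x *\<^sub>R w x) \<in> borel_measurable lebesgue"
        using w_box unfolding set_integrable_def by (rule borel_measurable_integrable)
    qed
    ultimately have "(LINT x:box a b|lebesgue. w x) = 0"
      by (simp add: set_lebesgue_integral_def LIMSEQ_const_iff)
    with w_box have "integral (box a b) w = 0"
      by (simp add: set_lebesgue_integral_eq_integral)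
    then show ?thesis by (simp add: integral_open_interval)
  qed
  obtain N where N: "negligible N" and ae: "\<And>x e. x \<notin> N \<Longrightarrow> 0 < e \<Longrightarrow>
      \<exists>d>0. \<forall>r. 0 < r \<and> r < d \<longrightarrow> norm (integral (cbox x (x + r *\<^sub>R One)) w /\<^sub>R r ^ DIM(real^'n) - w x) < e"
    using integrable_ccontinuous_explicit[of w] w_abs set_lebesgue_integral_eq_integral(1) by metis
  have "w x = 0" if x: "x \<notin> N" for x
  proof (rule ccontr)
    assume "w x \<noteq> 0"
    then obtain d :: real where "d > 0" "\<forall>r>0. \<not> r < d"
      using ae[OF x, of "norm (w x)"] by (auto simp: zero)
    then show False using dense by blast
  qed
  then have "AE x in lebesgue. w x = 0"
    using N by (intro AE_I'[of N]) (auto simp: negligible_iff_null_sets)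
  then show ?thesis by (simp add: w_def)
qed

lemma PM_norm_le:
  fixes u :: "(real^'n::finite \<Rightarrow> complex) \<Rightarrow> complex"
  assumes g: "has_density (fourier_dist u) g"
    and bound: "\<And>\<xi>. \<xi> \<noteq> 0 \<Longrightarrow> norm \<xi> powr k * cmod (g \<xi>) \<le> B"
  shows "PM_norm k u \<le> ereal B"
proof -
  let ?h = "density_of (fourier_dist u)"
  have h: "has_density (fourier_dist u) ?h"
    unfolding density_of_def by (rule someI[of _ g]) (rule g)
  then have [measurable]: "?h \<in> borel_measurable lebesgue"
    by (auto simp: has_density_def intro: locally_integrable_measurable)
  have nz: "AE \<xi> in lebesgue. (\<xi>::real^'n) \<noteq> 0"
    by (simp add: AE_completion_iff AE_lborel_singleton)
  have [measurable]: "(\<lambda>\<xi>::real^'n. norm \<xi> powr k) \<in> borel_measurable lebesgue"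
    by (rule measurable_completion) simp
  show ?thesis
    unfolding PM_norm_def
  proof (rule esssup_I)
    show "(\<lambda>\<xi>. ereal (norm \<xi> powr k * cmod (?h \<xi>))) \<in> borel_measurable lebesgue" by measurable
    show "AE \<xi> in lebesgue. ereal (norm \<xi> powr k * cmod (?h \<xi>)) \<le> ereal B"
      using density_unique[OF g h] nz by eventually_elim (metis bound ereal_less_eq(3))
  qed
qed

section \<open>Functions with an explicit distributional Fourier transform\<close>

text \<open>The function \<open>g\<close> is the distributional Fourier transform of
  \<open>V\<close>, tested on decaying functions with decaying transform. Modulations of
  such functions are again of this kind, which gives access to the translates of
  \<open>V\<close>.\<close>

definition fourier_pair :: "(real^'n::finite \<Rightarrow> complex) \<Rightarrow> (real^'n \<Rightarrow> complex) \<Rightarrow> bool" where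
  "fourier_pair V g \<longleftrightarrow> V \<in> borel_measurable borel \<and> g \<in> borel_measurable borel \<and>
     (\<forall>f. decaying f \<longrightarrow> integrable lborel (\<lambda>x. V x * f x) \<and> integrable lborel (\<lambda>x. g x * f x)) \<and>
     (\<forall>\<phi>. decaying \<phi> \<longrightarrow> decaying (fourier \<phi>) \<longrightarrow>
        (LINT x|lborel. V x * fourier \<phi> x) = (LINT \<xi>|lborel. g \<xi> * \<phi> \<xi>))"

lemma fourier_pair_zero: "fourier_pair (\<lambda>_. 0) (\<lambda>_. 0)"
  by (simp add: fourier_pair_def)

lemma fourier_pair_add:
  assumes "fourier_pair V g" "fourier_pair W h"
  shows "fourier_pair (\<lambda>x. V x + W x) (\<lambda>x. g x + h x)"
  using assms by (auto simp: fourier_pair_def distrib_right)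

lemma fourier_pair_cmult:
  assumes "fourier_pair V g"
  shows "fourier_pair (\<lambda>x. c * V x) (\<lambda>x. c * g x)"
  using assms by (auto simp: fourier_pair_def mult.assoc)

lemma fourier_pair_sum:
  assumes "finite I" "\<And>i. i \<in> I \<Longrightarrow> fourier_pair (V i) (g i)"
  shows "fourier_pair (\<lambda>x. \<Sum>i\<in>I. V i x) (\<lambda>x. \<Sum>i\<in>I. g i x)"
  using assms by (induction I rule: finite_induct) (auto simp: fourier_pair_zero fourier_pair_add)

text \<open>Shifting \<open>V\<close> amounts to shifting \<open>fourier \<phi>\<close> the other
  way, and this is the transform of a modulation of \<open>\<phi>\<close>.\<close>

lemma fourier_pair_translate:
  fixes V g :: "real^'n::finite \<Rightarrow> complex"
  assumes "fourier_pair V g"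
  shows "fourier_pair (\<lambda>x. V (x - a)) (\<lambda>\<xi>. g \<xi> * cis (- 2 * pi * (a \<bullet> \<xi>)))"
  unfolding fourier_pair_def
proof (intro conjI allI impI)
  let ?E = "\<lambda>\<xi>. cis (- 2 * pi * (a \<bullet> \<xi>))"
  have [measurable]: "V \<in> borel_measurable borel" "g \<in> borel_measurable borel"
    using assms by (auto simp: fourier_pair_def)
  show "(\<lambda>x. V (x - a)) \<in> borel_measurable borel" by measurable
  show "(\<lambda>\<xi>. g \<xi> * ?E \<xi>) \<in> borel_measurable borel" unfolding cis_conv_exp by measurable
  have shift: "integrable lborel (\<lambda>x. V (x - a) * f x)"
    "(LINT x|lborel. V (x - a) * f x) = (LINT x|lborel. V x * f (x + a))" if f: "decaying f" for f
  proof -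
    have [measurable]: "f \<in> borel_measurable borel" using f by (simp add: decaying_def)
    have m: "(\<lambda>x. V (x - a) * f x) \<in> borel_measurable borel" by measurable
    show "(LINT x|lborel. V (x - a) * f x) = (LINT x|lborel. V x * f (x + a))"
      using lborel_integral_translate[OF m, of a] by simp
    have "integrable lborel (\<lambda>x. V x * f (x + a))"
      using assms decaying_translate[OF f, of a] by (simp add: fourier_pair_def)
    then show "integrable lborel (\<lambda>x. V (x - a) * f x)"
      using lborel_integrable_translate[OF m, of a] by simp
  qed
  show "integrable lborel (\<lambda>x. V (x - a) * f x)" if "decaying f" for f
    by (rule shift(1)[OF that])
  show "integrable lborel (\<lambda>\<xi>. g \<xi> * ?E \<xi> * f \<xi>)" if f: "decaying f" for f
  proof -
    have "integrable lborel (\<lambda>\<xi>. g \<xi> * (f \<xi> * ?E \<xi>))"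
      using assms decaying_mult_cis[OF f, of "- 2 * pi" a] by (simp add: fourier_pair_def)
    then show ?thesis by (simp add: mult_ac)
  qed
  fix \<phi> :: "real^'n \<Rightarrow> complex"
  assume \<phi>: "decaying \<phi>" and F\<phi>: "decaying (fourier \<phi>)"
  have dec: "decaying (\<lambda>\<xi>. \<phi> \<xi> * ?E \<xi>)" by (rule decaying_mult_cis[OF \<phi>])
  have "fourier \<phi> (x + a) = fourier (\<lambda>\<xi>. \<phi> \<xi> * ?E \<xi>) x" for x
  proof -
    have "cis (- 2 * pi * ((x + a) \<bullet> \<xi>)) = ?E \<xi> * cis (- 2 * pi * (x \<bullet> \<xi>))" for \<xi>
      by (simp add: cis_mult inner_add_left algebra_simps)
    then show ?thesis
      using \<phi> dec unfolding decaying_def by (simp only: fourier_conv_cis mult.assoc)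
  qed
  then have eq: "(\<lambda>x. fourier \<phi> (x + a)) = fourier (\<lambda>\<xi>. \<phi> \<xi> * ?E \<xi>)" by (rule ext)
  have "(LINT x|lborel. V (x - a) * fourier \<phi> x) = (LINT x|lborel. V x * fourier (\<lambda>\<xi>. \<phi> \<xi> * ?E \<xi>) x)"
    unfolding eq[symmetric] by (rule shift(2)[OF F\<phi>])
  also have "\<dots> = (LINT \<xi>|lborel. g \<xi> * (\<phi> \<xi> * ?E \<xi>))"
    using assms dec decaying_translate[OF F\<phi>, of a] unfolding eq fourier_pair_def by blast
  finally show "(LINT x|lborel. V (x - a) * fourier \<phi> x) = (LINT \<xi>|lborel. g \<xi> * ?E \<xi> * \<phi> \<xi>)"
    by (simp add: mult_ac)
qed

lemma regular_dist_conv_lborel: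
  assumes "V \<in> borel_measurable borel" "f \<in> borel_measurable borel"
  shows "regular_dist V f = (LINT x|lborel. V x * f x)"
    and "integrable lborel (\<lambda>x. V x * f x) \<Longrightarrow> integrable lebesgue (\<lambda>x. V x * f x)"
proof -
  have "(\<lambda>x. V x * f x) \<in> borel_measurable lborel" using assms by simp
  then show "regular_dist V f = (LINT x|lborel. V x * f x)"
    "integrable lborel (\<lambda>x. V x * f x) \<Longrightarrow> integrable lebesgue (\<lambda>x. V x * f x)"
    unfolding regular_dist_def by (simp_all add: integral_completion integrable_completion)
qed

lemma schwartz_seminorm_upper:
  fixes f g :: "real^'n::finite \<Rightarrow> complex"
  assumes f: "f \<in> schwartz" and g: "g \<in> schwartz"
  shows "norm x ^ N * cmod (g x - f x) \<le> schwartz_seminorm N [] (\<lambda>x. g x - f x)"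
proof -
  have bdd: "\<exists>B. \<forall>x. norm x ^ N * cmod (h x) \<le> B" if "h \<in> schwartz" for h :: "real^'n \<Rightarrow> complex"
  proof -
    have "\<forall>N is. bounded (range (\<lambda>x. norm x ^ N * cmod (partial_derivs is h x)))"
      using that by (simp add: schwartz_def)
    from this[rule_format, of N "[]"] show ?thesis by (auto simp: bounded_iff)
  qed
  obtain B1 where B1: "\<And>x. norm x ^ N * cmod (f x) \<le> B1" using bdd[OF f] by auto
  obtain B2 where B2: "\<And>x. norm x ^ N * cmod (g x) \<le> B2" using bdd[OF g] by auto
  have "norm x ^ N * cmod (g x - f x) \<le> B2 + B1" for x
  proof -
    have "norm x ^ N * cmod (g x - f x) \<le> norm x ^ N * (cmod (g x) + cmod (f x))"
      by (intro mult_left_mono norm_triangle_ineq4) auto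
    then show ?thesis using B1[of x] B2[of x] by (simp add: distrib_left)
  qed
  then have "bdd_above (range (\<lambda>x. norm x ^ N * cmod (g x - f x)))" by (auto intro!: bdd_aboveI)
  then show ?thesis
    unfolding schwartz_seminorm_def partial_derivs.simps by (rule cSUP_upper[OF UNIV_I])
qed

lemma openin_schwartz_ball:
  fixes f :: "real^'n::finite \<Rightarrow> complex"
  assumes "f \<in> schwartz" "e > 0"
  shows "openin schwartz_topology {g \<in> schwartz. schwartz_seminorm N is (\<lambda>x. g x - f x) < e}"
  unfolding schwartz_topology_def using assms by (intro topology_generated_by_Basis) blast

lemma schwartz_seminorm_diff_self: "schwartz_seminorm N [] (\<lambda>x. f x - f x) = 0"
  by (simp add: schwartz_seminorm_def)

lemma topspace_schwartz_topology: "topspace (schwartz_topology :: (real^'n::finite \<Rightarrow> complex) topology) = schwartz"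
proof
  show "topspace schwartz_topology \<subseteq> (schwartz :: (real^'n \<Rightarrow> complex) set)"
    unfolding schwartz_topology_def topology_generated_by_topspace by blast
  show "(schwartz :: (real^'n \<Rightarrow> complex) set) \<subseteq> topspace schwartz_topology"
  proof
    fix f :: "real^'n \<Rightarrow> complex" assume f: "f \<in> schwartz"
    have "f \<in> {g \<in> schwartz. schwartz_seminorm 0 [] (\<lambda>x. g x - f x) < 1}"
      using f by (simp only: mem_Collect_eq schwartz_seminorm_diff_self) simp
    with openin_subset[OF openin_schwartz_ball[OF f zero_less_one]] show "f \<in> topspace schwartz_topology" by blast
  qed
qed

text \<open>The weight \<open>w = (1 + |x|\<^sup>2)\<^bsup>-n\<^esup>\<close> is itself decaying, so
  \<open>V w\<close> is integrable. If \<open>g - f\<close> is small in the two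
  seminorms of orders \<open>0\<close> and \<open>2 * n\<close>, then \<open>|g -
  f|\<close> is at most a small multiple of \<open>w\<close>, and the values of the
  functional differ by at most that multiple of the integral of \<open>|V| w\<close>.\<close>

lemma tempered_regular_dist:
  fixes V :: "real^'n::finite \<Rightarrow> complex"
  assumes Vm [measurable]: "V \<in> borel_measurable borel"
    and V: "\<And>f. decaying f \<Longrightarrow> integrable lborel (\<lambda>x. V x * f x)"
  shows "tempered_distribution (regular_dist V)"
proof -
  have S: "f \<in> borel_measurable borel" "integrable lborel (\<lambda>x. V x * f x)" if "f \<in> schwartz" for f
    using schwartz_imp_decaying[OF that] V by (auto simp: decaying_def)
  have reg: "regular_dist V f = (LINT x|lborel. V x * f x)" if "f \<in> schwartz" for f
    using S[OF that] by (intro regular_dist_conv_lborel) auto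
  let ?w = "\<lambda>x::real^'n. 1 / (1 + (norm x)\<^sup>2) ^ CARD('n)"
  define M where "M = (LINT x|lborel. cmod (V x * of_real (?w x)))"
  have w_dec: "decaying (\<lambda>x. complex_of_real (?w x))"
  proof (rule decayingI)
    have "(1 + (norm x)\<^sup>2) ^ CARD('n) > 0" for x :: "real^'n" by (simp add: add_pos_nonneg)
    then show "cmod (complex_of_real (?w x)) * (1 + (norm x)\<^sup>2) ^ CARD('n) \<le> 1" for x
      unfolding norm_of_real by (simp add: less_imp_le)
  qed measurable
  have M_int: "integrable lborel (\<lambda>x. cmod (V x * of_real (?w x)))"
    using V[OF w_dec] by (rule integrable_norm)
  have "M \<ge> 0" unfolding M_def by simp
  have close: "cmod (regular_dist V g - regular_dist V f) \<le> 2 ^ CARD('n) * (2 * e) * M"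
    if f: "f \<in> schwartz" and g: "g \<in> schwartz"
      and e: "schwartz_seminorm 0 [] (\<lambda>x. g x - f x) < e" "schwartz_seminorm (2 * CARD('n)) [] (\<lambda>x. g x - f x) < e"
    for f g e
  proof -
    have b: "cmod (g x - f x) \<le> 2 ^ CARD('n) * (2 * e) * ?w x" for x
    proof -
      have pos: "(1 + (norm x)\<^sup>2) ^ CARD('n) > 0" by (simp add: add_pos_nonneg)
      have "cmod (g x - f x) * (1 + (norm x)\<^sup>2) ^ CARD('n) \<le> cmod (g x - f x) * (2 ^ CARD('n) * (1 + ((norm x)\<^sup>2) ^ CARD('n)))"
        by (intro mult_left_mono one_plus_power_le) auto
      also have "\<dots> = 2 ^ CARD('n) * (norm x ^ 0 * cmod (g x - f x) + norm x ^ (2 * CARD('n)) * cmod (g x - f x))"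
        unfolding power_mult by (simp add: distrib_left mult_ac)
      also have "\<dots> \<le> 2 ^ CARD('n) * (e + e)"
        using schwartz_seminorm_upper[OF f g, of x 0] schwartz_seminorm_upper[OF f g, of x "2 * CARD('n)"] e
        by (intro mult_left_mono add_mono) (linarith, linarith, simp)
      finally show ?thesis using pos by (simp add: pos_le_divide_eq)
    qed
    have "regular_dist V g - regular_dist V f = (LINT x|lborel. V x * (g x - f x))"
      using S(2)[OF f] S(2)[OF g] by (simp add: reg f g right_diff_distrib)
    also have "cmod \<dots> \<le> (LINT x|lborel. cmod (V x * (g x - f x)))"
      by (rule integral_norm_bound)
    also have "\<dots> \<le> (LINT x|lborel. 2 ^ CARD('n) * (2 * e) * cmod (V x * of_real (?w x)))"
    proof (rule integral_mono)
      show "integrable lborel (\<lambda>x. cmod (V x * (g x - f x)))"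
        using S(2)[OF f] S(2)[OF g] by (simp add: right_diff_distrib)
      show "integrable lborel (\<lambda>x. 2 ^ CARD('n) * (2 * e) * cmod (V x * of_real (?w x)))"
        by (intro integrable_mult_right M_int)
      show "cmod (V x * (g x - f x)) \<le> 2 ^ CARD('n) * (2 * e) * cmod (V x * of_real (?w x))" for x
      proof -
        have "cmod (complex_of_real (?w x)) = ?w x" unfolding norm_of_real by (simp add: abs_of_nonneg)
        then have "2 ^ CARD('n) * (2 * e) * cmod (V x * of_real (?w x)) = cmod (V x) * (2 ^ CARD('n) * (2 * e) * ?w x)"
          by (simp only: norm_mult) simp
        then show ?thesis using mult_left_mono[OF b[of x], of "cmod (V x)"] by (simp only: norm_mult) simp
      qed
    qed
    also have "\<dots> = 2 ^ CARD('n) * (2 * e) * M" by (simp only: M_def integral_mult_right_zero)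
    finally show ?thesis .
  qed
  have "continuous_map schwartz_topology euclidean (regular_dist V)"
    unfolding continuous_map_def
  proof (intro conjI allI impI)
    show "regular_dist V \<in> topspace schwartz_topology \<rightarrow> topspace euclidean" by simp
    fix U :: "complex set" assume "openin euclidean U"
    then have U: "open U" by simp
    show "openin schwartz_topology {f \<in> topspace schwartz_topology. regular_dist V f \<in> U}" (is "openin _ ?P")
    proof (subst openin_subopen, intro ballI)
      fix f assume "f \<in> ?P"
      then have f: "f \<in> schwartz" "regular_dist V f \<in> U" by (auto simp: topspace_schwartz_topology)
      obtain \<epsilon> where \<epsilon>: "\<epsilon> > 0" "ball (regular_dist V f) \<epsilon> \<subseteq> U"
        using U f(2) by (meson open_contains_ball)
      \<comment> \<open>The denominator contains \<open>M + 1\<close> rather than \<open>M\<close>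
          because \<open>M\<close> may be 0.\<close>
      define e where "e = \<epsilon> / (2 ^ CARD('n) * 2 * (M + 1))"
      have e: "e > 0" using \<epsilon> \<open>M \<ge> 0\<close> by (simp add: e_def)
      have "2 ^ CARD('n) * (2 * e) * M < 2 ^ CARD('n) * (2 * e) * (M + 1)" using e by simp
      also have "\<dots> = \<epsilon>" using \<open>M \<ge> 0\<close> by (simp add: e_def)
      finally have eM: "2 ^ CARD('n) * (2 * e) * M < \<epsilon>" .
      define T where "T = {g \<in> schwartz. schwartz_seminorm 0 [] (\<lambda>x. g x - f x) < e}
         \<inter> {g \<in> schwartz. schwartz_seminorm (2 * CARD('n)) [] (\<lambda>x. g x - f x) < e}"
      have "openin schwartz_topology T"
        unfolding T_def by (intro openin_Int openin_schwartz_ball f e)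
      moreover have "f \<in> T"
        unfolding T_def using f e by (simp only: Int_iff mem_Collect_eq schwartz_seminorm_diff_self)
      moreover have "T \<subseteq> ?P"
      proof
        fix g assume g: "g \<in> T"
        then have "cmod (regular_dist V g - regular_dist V f) < \<epsilon>"
          using close[OF f(1), of g e] eM by (auto simp: T_def)
        then have "regular_dist V g \<in> U" using \<epsilon>(2) by (auto simp: dist_norm norm_minus_commute)
        with g show "g \<in> ?P" by (auto simp: T_def topspace_schwartz_topology)
      qed
      ultimately show "\<exists>T. openin schwartz_topology T \<and> f \<in> T \<and> T \<subseteq> ?P" by blast
    qed
  qed
  moreover have "regular_dist V (\<lambda>x. f x + g x) = regular_dist V f + regular_dist V g"
    if "f \<in> schwartz" "g \<in> schwartz" for f g
    using S[OF that(1)] S[OF that(2)] reg[OF that(1)] reg[OF that(2)]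
    by (subst regular_dist_conv_lborel) (auto simp: distrib_left)
  moreover have "regular_dist V (\<lambda>x. c * f x) = c * regular_dist V f" for c f
    unfolding regular_dist_def by (simp add: mult.left_commute[of _ c])
  ultimately show ?thesis by (auto simp: tempered_distribution_def)
qed

text \<open>Test functions are admissible in the pairing, so \<open>g\<close> is a density of the
  transformed distribution, and as densities are unique the bound on \<open>g\<close> is
  a bound on the norm. Local integrability of \<open>g\<close> is part of the pairing
  too, because indicators of compact sets decay.\<close>

theorem fourier_pair_PM:
  fixes V g :: "real^'n::finite \<Rightarrow> complex"
  assumes pair: "fourier_pair V g"
    and bound: "\<And>\<xi>. \<xi> \<noteq> 0 \<Longrightarrow> norm \<xi> powr k * cmod (g \<xi>) \<le> B"
  shows "in_PM k V" and "PM_norm k (regular_dist V) \<le> ereal B"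
proof -
  have [measurable]: "V \<in> borel_measurable borel" "g \<in> borel_measurable borel"
    and int: "\<And>f. decaying f \<Longrightarrow> integrable lborel (\<lambda>x. V x * f x)"
      "\<And>f. decaying f \<Longrightarrow> integrable lborel (\<lambda>x. g x * f x)"
    using pair by (auto simp: fourier_pair_def)
  have loc: "locally_integrable g"
    unfolding locally_integrable_def set_integrable_def
  proof (intro allI impI)
    fix S :: "(real^'n) set" assume S: "compact S"
    then have [measurable]: "S \<in> sets borel" by (intro borel_compact)
    obtain R where R: "\<And>x. x \<in> S \<Longrightarrow> norm x \<le> R"
      using compact_imp_bounded[OF S] unfolding bounded_iff by auto
    have "decaying (indicator S :: real^'n \<Rightarrow> complex)"
    proof (rule decayingI)
      show "cmod (indicator S x) * (1 + (norm x)\<^sup>2) ^ CARD('n) \<le> (1 + R\<^sup>2) ^ CARD('n)" for x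
        using R[of x] by (cases "x \<in> S") (auto intro!: power_mono add_mono)
    qed measurable
    from int(2)[OF this] have "integrable lborel (\<lambda>x. indicator S x *\<^sub>R g x)"
      by (rule Bochner_Integration.integrable_cong[THEN iffD1, rotated -1]) (auto simp: indicator_def)
    then show "integrable lebesgue (\<lambda>x. indicator S x *\<^sub>R g x)"
      by (subst integrable_completion) auto
  qed
  have dens: "has_density (fourier_dist (regular_dist V)) g"
    unfolding has_density_def
  proof (intro conjI ballI loc)
    fix \<phi> :: "real^'n \<Rightarrow> complex" assume \<phi>: "\<phi> \<in> test_functions"
    have dec: "decaying \<phi>" by (rule test_function_decaying[OF \<phi>])
    then have [measurable]: "\<phi> \<in> borel_measurable borel" by (simp add: decaying_def)
    have dec': "decaying (fourier \<phi>)"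
      by (rule test_function_fourier_decaying[OF \<phi>])
    then have "fourier \<phi> \<in> borel_measurable borel" by (simp add: decaying_def)
    then have "fourier_dist (regular_dist V) \<phi> = (LINT x|lborel. V x * fourier \<phi> x)"
      unfolding fourier_dist_def by (intro regular_dist_conv_lborel) measurable
    also have "\<dots> = (LINT \<xi>|lborel. g \<xi> * \<phi> \<xi>)"
      using pair dec dec' unfolding fourier_pair_def by blast
    also have "\<dots> = regular_dist g \<phi>"
      by (rule regular_dist_conv_lborel(1)[symmetric]) measurable
    finally show "fourier_dist (regular_dist V) \<phi> = (LINT x|lebesgue. g x * \<phi> x)"
      by (simp add: regular_dist_def)
  qed
  show le: "PM_norm k (regular_dist V) \<le> ereal B"
    by (rule PM_norm_le[OF dens bound])
  have "integrable lebesgue (\<lambda>x. V x * \<phi> x)" if "\<phi> \<in> schwartz" for \<phi>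
    using schwartz_imp_decaying[OF that] int(1)[OF schwartz_imp_decaying[OF that]]
    by (intro regular_dist_conv_lborel(2)) (auto simp: decaying_def)
  moreover have "PM_norm k (regular_dist V) < \<infinity>"
    using le by (rule order_le_less_trans) simp
  ultimately show "in_PM k V"
    unfolding in_PM_def PM_def using tempered_regular_dist[OF _ int(1)] dens by auto
qed

section \<open>The two kernels and the constants\<close>

lemma nu_plus_2:
  assumes "\<theta> > 0"
  shows "nu (\<theta> + 2) = \<theta> / (2 * pi) * nu \<theta>"
proof -
  have "Gamma (\<theta> / 2 + 1) = \<theta> / 2 * Gamma (\<theta> / 2)"
    using assms by (intro Gamma_plus1) (auto elim!: nonpos_Ints_cases)
  then have G: "Gamma ((\<theta> + 2) / 2) = \<theta> / 2 * Gamma (\<theta> / 2)"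
    by (simp add: add_divide_distrib)
  have P: "pi powr (- (\<theta> + 2) / 2) = pi powr (- \<theta> / 2) / pi"
  proof -
    have "- (\<theta> + 2) / 2 = - \<theta> / 2 - 1" by (simp add: field_simps)
    then have "pi powr (- (\<theta> + 2) / 2) = pi powr (- \<theta> / 2 - 1)" by (rule arg_cong)
    also have "\<dots> = pi powr (- \<theta> / 2) / pi" by (simp add: powr_diff)
    finally show ?thesis .
  qed
  show ?thesis unfolding nu_def G P by (simp add: mult_ac)
qed

lemma nu_pos: "\<theta> > 0 \<Longrightarrow> nu \<theta> > 0"
  by (simp add: nu_def Gamma_real_pos)

lemma nu_1: "nu 1 = 1"
  by (simp add: nu_def Gamma_one_half_real powr_minus powr_half_sqrt)

lemma nu_2: "nu 2 = 1 / pi"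
  by (simp add: nu_def powr_minus_divide)

lemma nu_3: "nu 3 = 1 / (2 * pi)"
  using nu_plus_2[of 1] by (simp add: nu_1)

text \<open>The case \<open>p = q = 1\<close>, \<open>c = 0\<close>, \<open>s = 1\<close> of
  \<open>homogeneous_fourier\<close>, divided by \<open>\<nu>\<^sub>2 = 1 /
  \<pi>\<close>. The transform has exponent \<open>2 * r = n - 2\<close>.\<close>

lemma fourier_pair_inverse_square:
  assumes n: "CARD('n::finite) \<ge> 3"
  defines "N \<equiv> real CARD('n)"
  shows "fourier_pair (\<lambda>x::real^'n. of_real (1 / (norm x)\<^sup>2)) (\<lambda>\<xi>. of_real (pi * nu (N - 2) * norm \<xi> powr (- (N - 2))))"
proof -
  have N: "N \<ge> 3" using n by (simp add: N_def)
  have int: "integrable lborel (\<lambda>x. of_real (1 / (norm x)\<^sup>2) * f x)"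
    "integrable lborel (\<lambda>x. of_real (pi * nu (N - 2) * norm x powr (- (N - 2))) * f x)"
    if f: "decaying f" for f :: "real^'n \<Rightarrow> complex"
  proof -
    show "integrable lborel (\<lambda>x. of_real (1 / (norm x)\<^sup>2) * f x)"
      by (rule integrable_homogeneous_mult_decaying[OF f, of _ 1 2])
        (use N in \<open>auto simp: N_def norm_divide norm_power powr_minus_divide\<close>)
    show "integrable lborel (\<lambda>x. of_real (pi * nu (N - 2) * norm x powr (- (N - 2))) * f x)"
      by (rule integrable_homogeneous_mult_decaying[OF f, of _ "pi * \<bar>nu (N - 2)\<bar>" "N - 2"])
        (use N in \<open>auto simp: N_def norm_mult\<close>)
  qed
  have eq: "(LINT x|lborel. of_real (1 / (norm x)\<^sup>2) * fourier \<phi> x)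
      = (LINT \<xi>|lborel. of_real (pi * nu (N - 2) * norm \<xi> powr (- (N - 2))) * \<phi> \<xi>)"
    if \<phi>: "decaying \<phi>" and \<psi>: "decaying (fourier \<phi>)" for \<phi> :: "real^'n \<Rightarrow> complex"
  proof -
    have r: "2 * (N / 2 + 0 - 1) = N - 2" by simp
    have "(LINT x|lborel. (1 * of_real (nu (2 * 1) * norm x powr (- (2 * 1)))) * fourier \<phi> x)
      = (LINT \<xi>|lborel. (1 * of_real (nu (N - 2) * norm \<xi> powr (- (N - 2)))) * \<phi> \<xi>)"
      unfolding r[symmetric] unfolding N_def
    proof (rule homogeneous_fourier[where D = 1 and E = 1])
      show "has_bochner_integral lborel (\<lambda>x. 1 * (of_real (exp (- (pi * t * (norm x)\<^sup>2))) * cis (- 2 * pi * (\<xi> \<bullet> x))))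
         (1 * of_real (t powr (- real CARD('n) / 2 - 0) * exp (- (pi * (norm \<xi>)\<^sup>2 / t))))" if "t > 0" for t and \<xi> :: "real^'n"
        using gaussian_fourier_vec[OF that, of \<xi>] by simp
    qed (use N \<phi> \<psi> in \<open>auto simp: N_def\<close>)
    then have "of_real pi * (LINT x|lborel. (1 * of_real (nu (2 * 1) * norm x powr (- (2 * 1)))) * fourier \<phi> x)
      = of_real pi * (LINT \<xi>|lborel. (1 * of_real (nu (N - 2) * norm \<xi> powr (- (N - 2)))) * \<phi> \<xi>)" by simp
    then show ?thesis
      unfolding integral_mult_right_zero[symmetric]
      by (simp add: nu_2 powr_minus_divide mult.assoc)
  qed
  show ?thesis
    unfolding fourier_pair_def using int eq by auto
qed

text \<open>The case \<open>c = 1\<close>, \<open>s = 3 / 2\<close> of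
  \<open>homogeneous_fourier\<close>, divided by \<open>\<nu>\<^sub>3 = 1 / (2
  \<pi>)\<close>. Here \<open>2 * r = n - 1\<close>, and the linear factors lower both
  singularities by one order.\<close>

lemma fourier_pair_dipole:
  fixes d :: "real^'n::finite"
  assumes n: "CARD('n) \<ge> 3"
  defines "N \<equiv> real CARD('n)"
  shows "fourier_pair (\<lambda>x. of_real (d \<bullet> x / norm x ^ 3))
     (\<lambda>\<xi>. - \<i> * of_real (d \<bullet> \<xi>) * of_real (2 * pi * nu (N - 1) * norm \<xi> powr (- (N - 1))))"
proof -
  have N: "N \<ge> 3" using n by (simp add: N_def)
  have cs: "\<bar>d \<bullet> x\<bar> \<le> norm d * norm x" for x :: "real^'n" by (rule Cauchy_Schwarz_ineq2)
  have b: "\<bar>d \<bullet> x\<bar> * (C * norm x powr (- s)) \<le> (norm d * C) * norm x powr (- (s - 1))"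
    if "x \<noteq> 0" "C \<ge> 0" for x :: "real^'n" and s C
  proof -
    have "\<bar>d \<bullet> x\<bar> * (C * norm x powr (- s)) \<le> (norm d * norm x) * (C * norm x powr (- s))"
      using cs[of x] that by (intro mult_right_mono) auto
    also have "\<dots> = (norm d * C) * norm x powr (- (s - 1))"
      using that by (simp add: powr_diff powr_minus field_simps)
    finally show ?thesis .
  qed
  have powr3: "1 / norm x ^ 3 = norm x powr (- 3)" if "x \<noteq> 0" for x :: "real^'n"
    using that by (simp add: powr_minus_divide)
  have int: "integrable lborel (\<lambda>x. of_real (d \<bullet> x / norm x ^ 3) * f x)"
    "integrable lborel (\<lambda>x. - \<i> * of_real (d \<bullet> x) * of_real (2 * pi * nu (N - 1) * norm x powr (- (N - 1))) * f x)"
    if f: "decaying f" for f :: "real^'n \<Rightarrow> complex"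
  proof -
    show "integrable lborel (\<lambda>x. of_real (d \<bullet> x / norm x ^ 3) * f x)"
    proof (rule integrable_homogeneous_mult_decaying[OF f, of _ "norm d" 2])
      show "cmod (of_real (d \<bullet> x / norm x ^ 3)) \<le> norm d * norm x powr (- 2)" if "x \<noteq> 0" for x
        using b[OF that, of 1 3] powr3[OF that] that by (simp add: norm_divide norm_mult norm_power divide_inverse)
    qed (use N in \<open>auto simp: N_def\<close>)
    show "integrable lborel (\<lambda>x. - \<i> * of_real (d \<bullet> x) * of_real (2 * pi * nu (N - 1) * norm x powr (- (N - 1))) * f x)"
    proof (rule integrable_homogeneous_mult_decaying[OF f, of _ "norm d * (2 * pi * \<bar>nu (N - 1)\<bar>)" "N - 2"])
      show "cmod (- \<i> * of_real (d \<bullet> x) * of_real (2 * pi * nu (N - 1) * norm x powr (- (N - 1))))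
         \<le> norm d * (2 * pi * \<bar>nu (N - 1)\<bar>) * norm x powr (- (N - 2))" if "x \<noteq> 0" for x
        using b[OF that, of "2 * pi * \<bar>nu (N - 1)\<bar>" "N - 1"] by (simp add: norm_mult mult.assoc)
    qed (use N in \<open>auto simp: N_def\<close>)
  qed
  have eq: "(LINT x|lborel. of_real (d \<bullet> x / norm x ^ 3) * fourier \<phi> x)
      = (LINT \<xi>|lborel. - \<i> * of_real (d \<bullet> \<xi>) * of_real (2 * pi * nu (N - 1) * norm \<xi> powr (- (N - 1))) * \<phi> \<xi>)"
    if \<phi>: "decaying \<phi>" and \<psi>: "decaying (fourier \<phi>)" for \<phi> :: "real^'n \<Rightarrow> complex"
  proof -
    have r: "2 * (N / 2 + 1 - 3 / 2) = N - 1" by simp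
    have "(LINT x|lborel. (of_real (d \<bullet> x) * of_real (nu (2 * (3 / 2)) * norm x powr (- (2 * (3 / 2))))) * fourier \<phi> x)
      = (LINT \<xi>|lborel. ((- \<i> * of_real (d \<bullet> \<xi>)) * of_real (nu (N - 1) * norm \<xi> powr (- (N - 1)))) * \<phi> \<xi>)"
      unfolding r[symmetric] unfolding N_def
    proof (rule homogeneous_fourier[where D = "norm d" and E = "norm d"])
      show "has_bochner_integral lborel (\<lambda>x. of_real (d \<bullet> x) * (of_real (exp (- (pi * t * (norm x)\<^sup>2))) * cis (- 2 * pi * (\<xi> \<bullet> x))))
         (- \<i> * of_real (d \<bullet> \<xi>) * of_real (t powr (- real CARD('n) / 2 - 1) * exp (- (pi * (norm \<xi>)\<^sup>2 / t))))" if "t > 0" for t and \<xi> :: "real^'n"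
        by (rule linear_gaussian_fourier_vec[OF that])
    qed (use N \<phi> \<psi> cs in \<open>auto simp: N_def norm_mult\<close>)
    then have "of_real (2 * pi) * (LINT x|lborel. (of_real (d \<bullet> x) * of_real (nu (2 * (3 / 2)) * norm x powr (- (2 * (3 / 2))))) * fourier \<phi> x)
      = of_real (2 * pi) * (LINT \<xi>|lborel. ((- \<i> * of_real (d \<bullet> \<xi>)) * of_real (nu (N - 1) * norm \<xi> powr (- (N - 1)))) * \<phi> \<xi>)"
      by (simp only:)
    then have *: "(LINT x|lborel. of_real (2 * pi) * ((of_real (d \<bullet> x) * of_real (nu (2 * (3 / 2)) * norm x powr (- (2 * (3 / 2))))) * fourier \<phi> x))
      = (LINT \<xi>|lborel. of_real (2 * pi) * (((- \<i> * of_real (d \<bullet> \<xi>)) * of_real (nu (N - 1) * norm \<xi> powr (- (N - 1)))) * \<phi> \<xi>))"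
      by (simp only: integral_mult_right_zero)
    have real: "2 * pi * ((d \<bullet> x) * (nu (2 * (3 / 2)) * norm x powr (- (2 * (3 / 2))))) = d \<bullet> x / norm x ^ 3" for x
    proof (cases "x = 0")
      case False
      have "norm x powr (- (2 * (3 / 2))) = 1 / norm x ^ 3" using powr3[OF False] by simp
      moreover have "nu (2 * (3 / 2)) = 1 / (2 * pi)" by (simp add: nu_3)
      ultimately show ?thesis by (simp only:) simp
    qed simp
    have "of_real (2 * pi) * ((of_real (d \<bullet> x) * of_real (nu (2 * (3 / 2)) * norm x powr (- (2 * (3 / 2))))) * fourier \<phi> x)
      = of_real (d \<bullet> x / norm x ^ 3) * fourier \<phi> x" for x
      unfolding real[symmetric] of_real_mult by (simp only: mult_ac)
    moreover have "of_real (2 * pi) * (((- \<i> * of_real (d \<bullet> \<xi>)) * of_real (nu (N - 1) * norm \<xi> powr (- (N - 1)))) * \<phi> \<xi>)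
      = - \<i> * of_real (d \<bullet> \<xi>) * of_real (2 * pi * nu (N - 1) * norm \<xi> powr (- (N - 1))) * \<phi> \<xi>" for \<xi>
      unfolding of_real_mult by (simp only: mult_ac)
    ultimately show ?thesis using * by (simp only:)
  qed
  show ?thesis
    unfolding fourier_pair_def using int eq by auto
qed

text \<open>Two of the quotients in \<open>K_const\<close> telescope by \<open>nu_plus_2\<close>:
  \<open>\<nu>\<^sub>n\<^sub>-\<^sub>k / \<nu>\<^sub>n\<^sub>-\<^sub>k\<^sub>+\<^sub>2 =
  2 \<pi> / (n - k)\<close> and \<open>\<nu>\<^sub>k\<^sub>-\<^sub>2 / \<nu>\<^sub>k = 2
  \<pi> / (k - 2)\<close>.\<close>

lemma inverse_C_const:
  assumes "2 < k" "k < n"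
  shows "1 / C_const n k = pi * nu (n - 2) * ((k - 2) * (n - k))"
proof -
  have 1: "nu (2 + (n - k)) = (n - k) / (2 * pi) * nu (n - k)"
    using nu_plus_2[of "n - k"] assms by (simp add: add.commute)
  have 2: "nu k = (k - 2) / (2 * pi) * nu (k - 2)"
    using nu_plus_2[of "k - 2"] assms by simp
  have "nu (n - k) > 0" "nu (k - 2) > 0" "nu (n - 2) > 0" using assms by (auto intro: nu_pos)
  moreover have 3: "n - 2 - (n - k) = k - 2" "n - (n - k) = k" by simp_all
  ultimately show ?thesis
    using assms unfolding C_const_def K_const_def 3 1 2 nu_2 by (simp add: field_simps power2_eq_square)
qed

text \<open>The dipole threshold is the number at which the norm bound \<open>2 \<pi>
  \<nu>\<^sub>n\<^sub>-\<^sub>1 |d|\<close> meets \<open>1 / C_const n k\<close>: the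
  Beta function is \<open>\<surd>\<pi> \<Gamma>((n - 1) / 2) / \<Gamma>(n / 2)\<close>,
  and the recurrence of Gamma lowers \<open>n / 2\<close> to \<open>(n - 2) / 2\<close>.\<close>

lemma dipole_bound_eq:
  assumes "n \<ge> 3"
  shows "2 * pi * nu (n - 1) * dipole_bound n k = pi * nu (n - 2) * ((k - 2) * (n - k))"
proof -
  define G1 where "G1 = Gamma ((n - 1) / 2)"
  define G2 where "G2 = Gamma ((n - 2) / 2)"
  have pos: "G1 > 0" "G2 > 0" using assms by (auto simp: G1_def G2_def Gamma_real_pos)
  have "Gamma ((n - 2) / 2 + 1) = (n - 2) / 2 * G2"
    unfolding G2_def using assms by (intro Gamma_plus1) (auto elim!: nonpos_Ints_cases)
  moreover have "1 / 2 + (n - 1) / 2 = (n - 2) / 2 + 1" by (simp add: field_simps)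
  ultimately have B: "Beta (1 / 2) ((n - 1) / 2) = sqrt pi * G1 / ((n - 2) / 2 * G2)"
    by (simp only: Beta_def Gamma_one_half_real G1_def)
  have "- (n - 2) / 2 = - (n - 1) / 2 + 1 / 2" by (simp add: field_simps)
  then have "pi powr (- (n - 2) / 2) = pi powr (- (n - 1) / 2) * sqrt pi"
    by (simp only: powr_add powr_half_sqrt pi_ge_zero)
  then have nu: "nu (n - 2) = pi powr (- (n - 1) / 2) * sqrt pi * G2" "nu (n - 1) = pi powr (- (n - 1) / 2) * G1"
    by (simp_all add: nu_def G1_def G2_def)
  have s: "sqrt pi * (sqrt pi * z) = pi * z" for z by (simp flip: mult.assoc)
  show ?thesis
    unfolding dipole_bound_def B nu using pos assms by (simp add: field_simps s)
qed

lemma norm_le_sum_norm: "norm d \<le> sum_norm d"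
  by (simp add: sum_norm_def norm_le_l1_cart)

section \<open>Multipolar potentials and the thresholds\<close>

lemma multipolar_potential:
  fixes x :: "nat \<Rightarrow> real^'n::finite" and lam :: "nat \<Rightarrow> real" and m :: nat
  assumes n: "CARD('n) \<ge> 3"
  defines "N \<equiv> real CARD('n)"
  defines "V \<equiv> \<lambda>y. complex_of_real (\<Sum>j=1..m. lam j / (norm (y - x j))\<^sup>2)"
  shows "in_PM (N - 2) V" and "PM_norm (N - 2) (regular_dist V) \<le> ereal (pi * nu (N - 2) * (\<Sum>j=1..m. \<bar>lam j\<bar>))"
proof -
  have N: "N \<ge> 3" using n by (simp add: N_def)
  define g where "g \<xi> = (\<Sum>j=1..m. of_real (lam j) *
      (of_real (pi * nu (N - 2) * norm \<xi> powr (- (N - 2))) * cis (- 2 * pi * (x j \<bullet> \<xi>))))" for \<xi>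
  have "fourier_pair (\<lambda>y. \<Sum>j=1..m. of_real (lam j) * of_real (1 / (norm (y - x j))\<^sup>2)) g"
    unfolding g_def N_def
    by (intro fourier_pair_sum fourier_pair_cmult fourier_pair_translate fourier_pair_inverse_square n) simp
  then have pair: "fourier_pair V g" by (simp add: V_def)
  have bound: "norm \<xi> powr (N - 2) * cmod (g \<xi>) \<le> pi * nu (N - 2) * (\<Sum>j=1..m. \<bar>lam j\<bar>)" if "\<xi> \<noteq> 0" for \<xi>
  proof -
    have "cmod (g \<xi>) \<le> (\<Sum>j=1..m. cmod (of_real (lam j) *
      (of_real (pi * nu (N - 2) * norm \<xi> powr (- (N - 2))) * cis (- 2 * pi * (x j \<bullet> \<xi>)))))"
      unfolding g_def by (rule norm_sum)
    also have "\<dots> = (\<Sum>j=1..m. \<bar>lam j\<bar>) * (pi * nu (N - 2) * norm \<xi> powr (- (N - 2)))"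
      using N nu_pos[of "N - 2"] by (simp add: norm_mult sum_distrib_right abs_mult)
    finally have "norm \<xi> powr (N - 2) * cmod (g \<xi>)
        \<le> norm \<xi> powr (N - 2) * ((\<Sum>j=1..m. \<bar>lam j\<bar>) * (pi * nu (N - 2) * norm \<xi> powr (- (N - 2))))"
      by (intro mult_left_mono) auto
    also have "\<dots> = (norm \<xi> powr (N - 2) * norm \<xi> powr (- (N - 2))) * (pi * nu (N - 2) * (\<Sum>j=1..m. \<bar>lam j\<bar>))"
      by (simp only: mult_ac)
    also have "norm \<xi> powr (N - 2) * norm \<xi> powr (- (N - 2)) = 1"
      using that by (simp flip: powr_add)
    finally show ?thesis by simp
  qed
  show "in_PM (N - 2) V" "PM_norm (N - 2) (regular_dist V) \<le> ereal (pi * nu (N - 2) * (\<Sum>j=1..m. \<bar>lam j\<bar>))"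
    by (rule fourier_pair_PM[OF pair bound]; assumption)+
qed

lemma dipolar_potential:
  fixes x d :: "nat \<Rightarrow> real^'n::finite" and m :: nat
  assumes n: "CARD('n) \<ge> 3"
  defines "N \<equiv> real CARD('n)"
  defines "V \<equiv> \<lambda>y. complex_of_real (\<Sum>j=1..m. ((y - x j) \<bullet> d j) / norm (y - x j) ^ 3)"
  shows "in_PM (N - 2) V" and "PM_norm (N - 2) (regular_dist V) \<le> ereal (2 * pi * nu (N - 1) * (\<Sum>j=1..m. sum_norm (d j)))"
proof -
  have N: "N \<ge> 3" using n by (simp add: N_def)
  define g where "g \<xi> = (\<Sum>j=1..m. (- \<i> * of_real (d j \<bullet> \<xi>) *
      of_real (2 * pi * nu (N - 1) * norm \<xi> powr (- (N - 1)))) * cis (- 2 * pi * (x j \<bullet> \<xi>)))" for \<xi>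
  have "fourier_pair (\<lambda>y. \<Sum>j=1..m. of_real (d j \<bullet> (y - x j) / norm (y - x j) ^ 3)) g"
    unfolding g_def N_def
    by (intro fourier_pair_sum fourier_pair_translate[where V = "\<lambda>x. of_real (d _ \<bullet> x / norm x ^ 3)"] fourier_pair_dipole n) simp
  then have pair: "fourier_pair V g" by (simp add: V_def inner_commute)
  have bound: "norm \<xi> powr (N - 2) * cmod (g \<xi>) \<le> 2 * pi * nu (N - 1) * (\<Sum>j=1..m. sum_norm (d j))" if "\<xi> \<noteq> 0" for \<xi>
  proof -
    have nu: "nu (N - 1) > 0" using N by (intro nu_pos) simp
    have "cmod (g \<xi>) \<le> (\<Sum>j=1..m. cmod ((- \<i> * of_real (d j \<bullet> \<xi>) *
      of_real (2 * pi * nu (N - 1) * norm \<xi> powr (- (N - 1)))) * cis (- 2 * pi * (x j \<bullet> \<xi>))))"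
      unfolding g_def by (rule norm_sum)
    also have "\<dots> = (\<Sum>j=1..m. \<bar>d j \<bullet> \<xi>\<bar> * (2 * pi * nu (N - 1) * norm \<xi> powr (- (N - 1))))"
      using nu by (simp add: norm_mult abs_mult)
    also have "\<dots> \<le> (\<Sum>j=1..m. (sum_norm (d j) * norm \<xi>) * (2 * pi * nu (N - 1) * norm \<xi> powr (- (N - 1))))"
    proof (intro sum_mono mult_right_mono)
      fix j
      have "\<bar>d j \<bullet> \<xi>\<bar> \<le> norm (d j) * norm \<xi>" by (rule Cauchy_Schwarz_ineq2)
      also have "\<dots> \<le> sum_norm (d j) * norm \<xi>" by (intro mult_right_mono norm_le_sum_norm) simp
      finally show "\<bar>d j \<bullet> \<xi>\<bar> \<le> sum_norm (d j) * norm \<xi>" .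
    qed (use nu in simp)
    also have "\<dots> = norm \<xi> * norm \<xi> powr (- (N - 1)) * (2 * pi * nu (N - 1) * (\<Sum>j=1..m. sum_norm (d j)))"
      unfolding sum_distrib_right[symmetric] by (simp only: mult_ac)
    finally have "norm \<xi> powr (N - 2) * cmod (g \<xi>) \<le> norm \<xi> powr (N - 2) *
       (norm \<xi> * norm \<xi> powr (- (N - 1)) * (2 * pi * nu (N - 1) * (\<Sum>j=1..m. sum_norm (d j))))"
      by (intro mult_left_mono) auto
    also have "\<dots> = (norm \<xi> powr (N - 2) * norm \<xi> powr 1 * norm \<xi> powr (- (N - 1))) * (2 * pi * nu (N - 1) * (\<Sum>j=1..m. sum_norm (d j)))"
      by (simp add: mult_ac)
    also have "norm \<xi> powr (N - 2) * norm \<xi> powr 1 * norm \<xi> powr (- (N - 1)) = 1"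
      using that by (simp only: powr_add[symmetric]) simp
    finally show ?thesis by simp
  qed
  show "in_PM (N - 2) V" "PM_norm (N - 2) (regular_dist V) \<le> ereal (2 * pi * nu (N - 1) * (\<Sum>j=1..m. sum_norm (d j)))"
    by (rule fourier_pair_PM[OF pair bound]; assumption)+
qed

text \<open>The difference of the two sides is \<open>(k - (n + 2) / 2)\<^sup>2\<close>.\<close>

lemma quadratic_le_lambda_star: "(k - 2) * (n - k) \<le> lambda_star n"
proof -
  have "lambda_star n - (k - 2) * (n - k) = (k - (n + 2) / 2)\<^sup>2"
    by (simp add: lambda_star_def power2_eq_square field_simps)
  then show ?thesis by (metis diff_ge_0_iff_ge zero_le_power2)
qed

lemma quadratic_at_vertex: "((n + 2) / 2 - 2) * (n - (n + 2) / 2) = lambda_star n"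
  by (simp add: lambda_star_def power2_eq_square field_simps)

lemma is_arg_max_quadratic:
  assumes "n > (2::real)"
  shows "is_arg_max (\<lambda>k. (k - 2) * (n - k)) (\<lambda>k. 2 < k \<and> k < n) ((n + 2) / 2)"
  using assms quadratic_le_lambda_star[of _ n] unfolding is_arg_max_def quadratic_at_vertex
  by (auto simp: not_less)

lemma is_arg_max_dipole_bound:
  assumes n: "n > (2::real)"
  shows "is_arg_max (dipole_bound n) (\<lambda>k. 2 < k \<and> k < n) ((n + 2) / 2)"
proof -
  have "Gamma (1 / 2 :: real) > 0" by (simp add: Gamma_one_half_real)
  moreover have "Gamma ((n - 1) / 2) > 0" by (rule Gamma_real_pos) (use n in simp)
  moreover have "Gamma (1 / 2 + (n - 1) / 2) > 0" 
    by (intro Gamma_real_pos add_pos_pos) (use n in simp_all)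
  ultimately have "Beta (1 / 2) ((n - 1) / 2) > 0"
    unfolding Beta_def by (intro divide_pos_pos mult_pos_pos)
  then have "dipole_bound n k \<le> dipole_bound n ((n + 2) / 2)" for k
    using n unfolding dipole_bound_def quadratic_at_vertex
    by (intro mult_left_mono divide_right_mono quadratic_le_lambda_star) auto
  then show ?thesis using n by (auto simp: is_arg_max_def not_less)
qed

lemma dipole_bound_at_vertex:
  "dipole_bound n ((n + 2) / 2) = pi / (n - 2) * (lambda_star n / Beta (1 / 2) ((n - 1) / 2))"
  unfolding dipole_bound_def quadratic_at_vertex ..

theorem corollary1p2:
  fixes n :: nat and k :: real
  assumes n_def: "n = CARD('n::finite)" and n_ge: "n \<ge> 3"
    and k_gt: "2 < k" and k_lt: "k < real n"
  shows
    "((\<forall>(m::nat) (lam::nat \<Rightarrow> real) (x::nat \<Rightarrow> real^'n).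
        (let V = (\<lambda>y. complex_of_real (\<Sum>j=1..m. lam j / (norm (y - x j))\<^sup>2)) in
          in_PM (real n - 2) V \<and>
          ((\<Sum>j=1..m. \<bar>lam j\<bar>) < (k - 2) * (real n - k) \<longrightarrow>
             PM_norm (real n - 2) (regular_dist V) < ereal (1 / C_const n k))))
      \<and> is_arg_max (\<lambda>k. (k - 2) * (real n - k)) (\<lambda>k. 2 < k \<and> k < real n) ((real n + 2) / 2)
      \<and> ((real n + 2) / 2 - 2) * (real n - (real n + 2) / 2) = lambda_star n)
     \<and>
     ((\<forall>d::real^'n.
        (let V = (\<lambda>y. complex_of_real (d \<bullet> y / norm y ^ 3)) in
          in_PM (real n - 2) V \<and>
          (sum_norm d < dipole_bound n k \<longrightarrow>
             PM_norm (real n - 2) (regular_dist V) < ereal (1 / C_const n k))))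
      \<and> is_arg_max (dipole_bound n) (\<lambda>k. 2 < k \<and> k < real n) ((real n + 2) / 2)
      \<and> dipole_bound n ((real n + 2) / 2)
          = pi / (real n - 2) * (lambda_star n / Beta (1 / 2) ((real n - 1) / 2)))
     \<and>
     ((\<forall>(m::nat) (x::nat \<Rightarrow> real^'n) (d::nat \<Rightarrow> real^'n).
        (let V = (\<lambda>y. complex_of_real (\<Sum>j=1..m. ((y - x j) \<bullet> d j) / norm (y - x j) ^ 3)) in
          in_PM (real n - 2) V \<and>
          ((\<Sum>j=1..m. sum_norm (d j)) < dipole_bound n k \<longrightarrow>
             PM_norm (real n - 2) (regular_dist V) < ereal (1 / C_const n k))))
      \<and> is_arg_max (dipole_bound n) (\<lambda>k. 2 < k \<and> k < real n) ((real n + 2) / 2)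
      \<and> dipole_bound n ((real n + 2) / 2)
          = pi / (real n - 2) * (lambda_star n / Beta (1 / 2) ((real n - 1) / 2)))"
proof -
  have card: "CARD('n) \<ge> 3" and N: "real CARD('n) = real n" using n_def n_ge by simp_all
  have N2: "real n > 2" using n_ge by simp
  have C: "1 / C_const n k = pi * nu (real n - 2) * ((k - 2) * (real n - k))"
    by (rule inverse_C_const[OF k_gt k_lt])
  have "nu (real n - 2) > 0" "nu (real n - 1) > 0" using N2 by (auto intro: nu_pos)
  have bound1: "ereal (pi * nu (real n - 2) * s) < ereal (1 / C_const n k)" if "s < (k - 2) * (real n - k)" for s
    unfolding C using \<open>nu (real n - 2) > 0\<close> that by simp
  have bound2: "ereal (2 * pi * nu (real n - 1) * s) < ereal (1 / C_const n k)" if "s < dipole_bound n k" for s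
  proof -
    have "2 * pi * nu (real n - 1) * s < 2 * pi * nu (real n - 1) * dipole_bound n k"
      using \<open>nu (real n - 1) > 0\<close> that by simp
    also have "\<dots> = 1 / C_const n k"
      unfolding C using n_ge by (intro dipole_bound_eq) simp
    finally show ?thesis by simp
  qed
  note multipolar = multipolar_potential[OF card, unfolded N]
  note dipolar = dipolar_potential[OF card, unfolded N]
  have dipole: "in_PM (real n - 2) (\<lambda>y. complex_of_real (d \<bullet> y / norm y ^ 3))"
    "PM_norm (real n - 2) (regular_dist (\<lambda>y. complex_of_real (d \<bullet> y / norm y ^ 3))) \<le> ereal (2 * pi * nu (real n - 1) * sum_norm d)"
    for d :: "real^'n"
    using dipolar[where m = 1 and x = "\<lambda>_. 0" and d = "\<lambda>_. d"] by (simp_all add: inner_commute)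
  show ?thesis
    unfolding Let_def
    using multipolar(1) order_le_less_trans[OF multipolar(2) bound1]
      dipole(1) order_le_less_trans[OF dipole(2) bound2]
      dipolar(1) order_le_less_trans[OF dipolar(2) bound2]
      is_arg_max_quadratic[OF N2] is_arg_max_dipole_bound[OF N2]
      quadratic_at_vertex[of "real n"] dipole_bound_at_vertex[of "real n"]
    by (intro conjI allI impI) assumption+
qed

end
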